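(* Let $n\ge 2$, let $q=p^m$ with $p$ prime and $m\ge 1$, let $T$ be a basis of $\mathbb{F}_q$ over $\mathbb{F}_p$, and let $\widehat{I}\subseteq\Delta_n$ be a closed set with set of covering relations $I$. Let $U:=UT_{\widehat{I}}(n,\mathbb{F}_q)$ be the pattern group associated with $\widehat{I}$, and let $\Gamma=(U,(U_{(i,j)})_{(i,j)\in I})$ be the coset incidence system with $U_{(i,j)}:=\langle e_{k,l}(t)\mid t\in T,\ (k,l)\in I\setminus\{(i,j)\}\rangle$ for $(i,j)\in I$. Let $B=\bigcap_{(i,j)\in I}U_{(i,j)}$. Then: (1) $U$ acts flag-transitively on $\Gamma$; (2) $\Gamma$ is a residually connected coset geometry; (3) $\Gamma$ is firm; (4) $\Gamma$ is thin if and only if $q=2$ and $B\trianglelefteq U$; (5) if $q\neq 2$ then $\Gamma$ is thick; moreover, if $B\trianglelefteq U$ and $\Gamma$ is thick, then $q\neq 2$.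
   Context: Pattern groups. $\Delta_n=\{(a,b)\in\mathbb{N}^2\mid 1\le a<b\le n\}$. A subset $S\subseteq\Delta_n$ is closed if $(i,j),(j,k)\in S$ implies $(i,k)\in S$. A closed set $\widehat{I}$ defines a strict partial order on $\{1,\dots,n\}$ by $i\prec j$ iff $(i,j)\in\widehat{I}$; its set of covering relations is $I=\{(i,j)\in\widehat{I}\mid \text{there is no }k\text{ with } i\prec k\prec j\}$. $UT(n,\mathbb{F}_q)$ is the group of $n\times n$ upper unitriangular matrices over $\mathbb{F}_q$; for $(i,j)\in\Delta_n$ and $t\in\mathbb{F}_q$, $e_{i,j}(t)$ is the unitriangular matrix with $(i,j)$-entry $t$ and all other off-diagonal entries $0$. The pattern group is $UT_{\widehat{I}}(n,\mathbb{F}_q)=\{g\in UT(n,\mathbb{F}_q)\mid g_{i,j}=0\text{ for all }(i,j)\in\Delta_n\setminus\widehat{I}\}$. Incidence geometry. An incidence system over a type set $I$ consists of a set $X$ of elements, a type map $X\to I$, and a symmetric reflexive incidence relation such that distinct incident elements have different types. A flag is a set of pairwise incident elements; its type is the set of types of its elements; a chamber is a flag of type $I$. It is an incidence geometry if all maximal flags are chambers. The residue of a flag $F$ is the incidence system of all elements not in $F$ that are incident to every element of $F$; its rank is $|I|-|F|$. The corank of $F$ is $|I|-|F|$. An incidence geometry is residually connected if all its residues (including the residue of the empty flag) of rank at least two have connected incidence graph. It is firm, thin, thick if every residue of a flag of corank one contains at least two, exactly two, more than two elements, respectively. Coset incidence system. Given a group $G$ and subgroups $(G_i)_{i\in I}$,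 the coset incidence system $(G,(G_i)_{i\in I})$ has as elements of type $i$ the left cosets $gG_i$ (elements of different types are regarded as distinct), and $gG_i$ is incident to $kG_j$ iff $gG_i\cap kG_j\ne\emptyset$. It is called a coset geometry if it is an incidence geometry. $G$ acts on it by left multiplication; $G$ acts flag-transitively if for each $J\subseteq I$ it is transitive on the flags of type $J$.
   Formalization: Claim (4) and the second half of (5) are stated only for nonempty Î; for Î = ∅ the geometry has rank 0 and is vacuously thin and thick with B = U, so (4) fails for q ≠ 2 and the last claim of (5) fails for q = 2. *)

theory Defs
  imports
    "HOL-Algebra.Coset"
    "HOL-Algebra.Generated_Groups"
    "HOL-Algebra.Group_Action"
    "HOL-Computational_Algebra.Primes"
    "Jordan_Normal_Form.Matrix"
begin

section \<open>Incidence geometry\<close>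

record ('x, 'i) incidence_structure =
  type_set :: "'i set"
  elements :: "'x set"
  type_map :: "'x \<Rightarrow> 'i"
  incident :: "'x \<Rightarrow> 'x \<Rightarrow> bool"

definition incidence_system :: "('x, 'i) incidence_structure \<Rightarrow> bool" where
  "incidence_system \<Gamma> \<longleftrightarrow>
     type_map \<Gamma> ` elements \<Gamma> \<subseteq> type_set \<Gamma> \<and>
     (\<forall>x\<in>elements \<Gamma>. incident \<Gamma> x x) \<and>
     (\<forall>x\<in>elements \<Gamma>. \<forall>y\<in>elements \<Gamma>. incident \<Gamma> x y \<longrightarrow> incident \<Gamma> y x) \<and>
     (\<forall>x\<in>elements \<Gamma>. \<forall>y\<in>elements \<Gamma>.
        incident \<Gamma> x y \<and> x \<noteq> y \<longrightarrow> type_map \<Gamma> x \<noteq> type_map \<Gamma> y)"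

definition flag :: "('x, 'i) incidence_structure \<Rightarrow> 'x set \<Rightarrow> bool" where
  "flag \<Gamma> F \<longleftrightarrow> F \<subseteq> elements \<Gamma> \<and> (\<forall>x\<in>F. \<forall>y\<in>F. incident \<Gamma> x y)"

definition flag_type :: "('x, 'i) incidence_structure \<Rightarrow> 'x set \<Rightarrow> 'i set" where
  "flag_type \<Gamma> F = type_map \<Gamma> ` F"

definition chamber :: "('x, 'i) incidence_structure \<Rightarrow> 'x set \<Rightarrow> bool" where
  "chamber \<Gamma> F \<longleftrightarrow> flag \<Gamma> F \<and> flag_type \<Gamma> F = type_set \<Gamma>"

definition maximal_flag :: "('x, 'i) incidence_structure \<Rightarrow> 'x set \<Rightarrow> bool" where
  "maximal_flag \<Gamma> F \<longleftrightarrow> flag \<Gamma> F \<and> (\<forall>F'. flag \<Gamma> F' \<and> F \<subseteq> F' \<longrightarrow> F' = F)"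

definition incidence_geometry :: "('x, 'i) incidence_structure \<Rightarrow> bool" where
  "incidence_geometry \<Gamma> \<longleftrightarrow>
     incidence_system \<Gamma> \<and> (\<forall>F. maximal_flag \<Gamma> F \<longrightarrow> chamber \<Gamma> F)"

definition residue ::
    "('x, 'i) incidence_structure \<Rightarrow> 'x set \<Rightarrow> ('x, 'i) incidence_structure" where
  "residue \<Gamma> F = \<Gamma>\<lparr>
     type_set := type_set \<Gamma> - flag_type \<Gamma> F,
     elements := {x \<in> elements \<Gamma>. x \<notin> F \<and> (\<forall>y\<in>F. incident \<Gamma> x y)}\<rparr>"

text \<open>The corank of a flag is also the rank of its residue. It is meaningful for finite type
  sets only; a flag then has at most as many elements as there are types.\<close>

definition corank :: "('x, 'i) incidence_structure \<Rightarrow> 'x set \<Rightarrow> nat" where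
  "corank \<Gamma> F = card (type_set \<Gamma>) - card F"

text \<open>Connectedness of the incidence graph; as usual, the graph without vertices is not
  connected.\<close>

definition incidence_connected :: "('x, 'i) incidence_structure \<Rightarrow> bool" where
  "incidence_connected \<Gamma> \<longleftrightarrow>
     elements \<Gamma> \<noteq> {} \<and>
     (\<forall>x\<in>elements \<Gamma>. \<forall>y\<in>elements \<Gamma>.
        (x, y) \<in> {(a, b). a \<in> elements \<Gamma> \<and> b \<in> elements \<Gamma> \<and> incident \<Gamma> a b}\<^sup>*)"

definition residually_connected :: "('x, 'i) incidence_structure \<Rightarrow> bool" where
  "residually_connected \<Gamma> \<longleftrightarrow>
     (\<forall>F. flag \<Gamma> F \<and> corank \<Gamma> F \<ge> 2 \<longrightarrow> incidence_connected (residue \<Gamma> F))"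

text \<open>Since infinite sets have cardinality 0, infinite residues are admitted separately.\<close>

definition firm :: "('x, 'i) incidence_structure \<Rightarrow> bool" where
  "firm \<Gamma> \<longleftrightarrow> (\<forall>F. flag \<Gamma> F \<and> corank \<Gamma> F = 1 \<longrightarrow>
     infinite (elements (residue \<Gamma> F)) \<or> card (elements (residue \<Gamma> F)) \<ge> 2)"

definition thin :: "('x, 'i) incidence_structure \<Rightarrow> bool" where
  "thin \<Gamma> \<longleftrightarrow> (\<forall>F. flag \<Gamma> F \<and> corank \<Gamma> F = 1 \<longrightarrow> card (elements (residue \<Gamma> F)) = 2)"

definition thick :: "('x, 'i) incidence_structure \<Rightarrow> bool" where
  "thick \<Gamma> \<longleftrightarrow> (\<forall>F. flag \<Gamma> F \<and> corank \<Gamma> F = 1 \<longrightarrow>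
     infinite (elements (residue \<Gamma> F)) \<or> card (elements (residue \<Gamma> F)) > 2)"


section \<open>Coset incidence systems\<close>

text \<open>The element \<open>gG\<^sub>i\<close> of type \<open>i\<close> is the pair \<open>(i, gG\<^sub>i)\<close>, so that elements of different
  types are distinct even if they coincide as subsets of \<open>G\<close>.\<close>

definition coset_incidence_system ::
    "('g, 'm) monoid_scheme \<Rightarrow> 'i set \<Rightarrow> ('i \<Rightarrow> 'g set) \<Rightarrow> ('i \<times> 'g set, 'i) incidence_structure"
  where
  "coset_incidence_system G I H = \<lparr>
     type_set = I,
     elements = {(i, g <#\<^bsub>G\<^esub> H i) | i g. i \<in> I \<and> g \<in> carrier G},
     type_map = fst,
     incident = (\<lambda>x y. snd x \<inter> snd y \<noteq> {})\<rparr>"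

definition coset_geometry ::
    "('g, 'm) monoid_scheme \<Rightarrow> 'i set \<Rightarrow> ('i \<Rightarrow> 'g set) \<Rightarrow> bool" where
  "coset_geometry G I H \<longleftrightarrow>
     group G \<and> (\<forall>i\<in>I. subgroup (H i) G) \<and> incidence_geometry (coset_incidence_system G I H)"

definition translate :: "('g, 'm) monoid_scheme \<Rightarrow> 'g \<Rightarrow> 'i \<times> 'g set \<Rightarrow> 'i \<times> 'g set" where
  "translate G g x = (fst x, g <#\<^bsub>G\<^esub> snd x)"

text \<open>For every \<open>J \<subseteq> I\<close>, left multiplication is a transitive action on the set of flags of
  type \<open>J\<close>. (Actions in \<^locale>\<open>transitive_action\<close> are by functions that are undefined outside
  the set acted upon, hence the restricted abstraction.)\<close>

definition acts_flag_transitively ::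
    "('g, 'm) monoid_scheme \<Rightarrow> 'i set \<Rightarrow> ('i \<Rightarrow> 'g set) \<Rightarrow> bool" where
  "acts_flag_transitively G I H \<longleftrightarrow>
     (\<forall>J\<subseteq>I. let \<Gamma> = coset_incidence_system G I H;
                \<F> = {F. flag \<Gamma> F \<and> flag_type \<Gamma> F = J}
            in transitive_action G \<F> (\<lambda>g. \<lambda>F\<in>\<F>. translate G g ` F))"


section \<open>Pattern groups\<close>

definition Delta :: "nat \<Rightarrow> (nat \<times> nat) set" where
  "Delta n = {(a, b). 1 \<le> a \<and> a < b \<and> b \<le> n}"

definition closed_pattern :: "nat \<Rightarrow> (nat \<times> nat) set \<Rightarrow> bool" where
  "closed_pattern n S \<longleftrightarrow> S \<subseteq> Delta n \<and> trans S"

definition covering_relations :: "(nat \<times> nat) set \<Rightarrow> (nat \<times> nat) set" where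
  "covering_relations S = {(i, j) \<in> S. \<nexists>k. (i, k) \<in> S \<and> (k, j) \<in> S}"

text \<open>Positions in \<^const>\<open>Delta\<close> are counted from 1, whereas the entries of the library's
  matrices are counted from 0.\<close>

definition entry :: "'a mat \<Rightarrow> nat \<Rightarrow> nat \<Rightarrow> 'a" where
  "entry g i j = g $$ (i - 1, j - 1)"

definition elem_unitriangular :: "nat \<Rightarrow> nat \<times> nat \<Rightarrow> 'a::zero_neq_one \<Rightarrow> 'a mat" where
  "elem_unitriangular n ij t =
     mat n n (\<lambda>(a, b). if a = b then 1 else if (Suc a, Suc b) = ij then t else 0)"

definition UT :: "nat \<Rightarrow> 'a::field mat monoid" where
  "UT n = \<lparr>
     carrier = {g \<in> carrier_mat n n. upper_triangular g \<and> (\<forall>i\<in>{1..n}. entry g i i = 1)},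
     monoid.mult = (*),
     one = 1\<^sub>m n\<rparr>"

definition pattern_group :: "nat \<Rightarrow> (nat \<times> nat) set \<Rightarrow> 'a::field mat monoid" where
  "pattern_group n S =
     (UT n)\<lparr>carrier := {g \<in> carrier (UT n). \<forall>(i, j)\<in>Delta n - S. entry g i j = 0}\<rparr>"


section \<open>Bases of a finite field over its prime field\<close>

text \<open>In positive characteristic, the image of the integers is already a field.\<close>

definition prime_subfield :: "'a::{field,finite} set" where
  "prime_subfield = range of_int"

definition prime_field_basis :: "'a::{field,finite} set \<Rightarrow> bool" where
  "prime_field_basis T \<longleftrightarrow>
     (\<forall>c \<in> T \<rightarrow> prime_subfield. (\<Sum>t\<in>T. c t * t) = 0 \<longrightarrow> (\<forall>t\<in>T. c t = 0)) \<and>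
     (\<forall>x. \<exists>c \<in> T \<rightarrow> prime_subfield. x = (\<Sum>t\<in>T. c t * t))"

end

theory Submission
  imports Defs
begin

text \<open>Write \<open>c = (a, b)\<close> for a covering relation of the pattern. The subgroup attached to \<open>c\<close> is itself a
pattern group, namely that of the transitive closure of the other covering relations. A matrix of
\<open>U\<close> lies in it iff its entries vanish on \<open>through c\<close>, the set of pairs \<open>i \<prec> j\<close> all of whose
saturated chains pass through \<open>c\<close>. By \<open>through_iff\<close> these are the pairs with
\<open>i \<preceq> a\<close> and \<open>b \<preceq> j\<close> such that every element between \<open>i\<close> and \<open>j\<close> is below \<open>a\<close> or above \<open>b\<close>.
An intersection of these subgroups over a set \<open>J\<close> of covering relations is again a pattern group,
that of \<open>avoiding J\<close>, and all claims about cosets become claims about these sets of pairs.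

\<^emph>\<open>Flags.\<close> All claims about flags rest on a Helly property: pairwise intersecting cosets
\<open>f c H\<^sub>c\<close> (\<open>c \<in> J\<close>) have a common element. It is built one superdiagonal at a time (\<open>helly_step\<close>).
Suppose each \<open>f c\<close> already vanishes at the pairs of \<open>through c\<close> with \<open>j - i < m\<close>. Right
multiplication by \<open>H\<^sub>c\<close> then leaves the entries of \<open>f c\<close> in \<open>through c\<close> with \<open>j - i = m\<close> unchanged.
A common element of \<open>f c H\<^sub>c\<close> and \<open>f d H\<^sub>d\<close> therefore shows that \<open>f c\<close> and \<open>f d\<close> agree
at the pairs with \<open>j - i = m\<close> that lie in both sets. So all the prescribed entries fit into a single
matrix of \<open>U\<close>, and multiplying by its inverse clears the superdiagonal \<open>m\<close>. By the Helly property every flag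
consists of the cosets of one group element, which gives flag-transitivity and completes every flag
to a chamber.

\<^emph>\<open>Residual connectedness.\<close> It now suffices that the stabilizer of a flag of type \<open>J\<close> is generated by
the stabilizers of types \<open>J \<union> {c}\<close>, if at least two \<open>c\<close> are outside \<open>J\<close>. A root \<open>(i, j)\<close> can
only be missing from all of the latter if it lies in \<open>through c\<close> for all these \<open>c\<close>. Two such
covering relations follow one another on each chain from \<open>i\<close> to \<open>j\<close>, and cutting between them
writes the root element as a commutator of available ones (\<open>avoiding_split\<close>).

\<^emph>\<open>Panels.\<close> Up to translation, the residue of a flag of corank one is the set of cosets \<open>u H\<^sub>c\<close> with \<open>u\<close> in the intersection
of the other subgroups. The root elements at \<open>c\<close> give exactly \<open>q\<close> of them, so the geometry is
firm, and thick for \<open>q \<noteq> 2\<close>. There are no further cosets iff \<open>c\<close> is the only pair in \<open>through c\<close>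
that lies in no other \<open>through d\<close>. This holds for all \<open>c\<close> iff \<open>avoiding covers\<close> is an ideal of the
order (closed under composition with \<open>\<prec>\<close> on both sides), which in turn means that \<open>B\<close> is normal.\<close>

section \<open>Coset geometries with a Helly property\<close>

locale subgroup_family = group G for G (structure) +
  fixes I :: "'i set" and H :: "'i \<Rightarrow> 'a set"
  assumes finite_types: "finite I"
    and subgroups: "i \<in> I \<Longrightarrow> subgroup (H i) G"
begin

abbreviation cosets :: "('i \<times> 'a set, 'i) incidence_structure" where
  "cosets \<equiv> coset_incidence_system G I H"

definition flag_at :: "'i set \<Rightarrow> 'a \<Rightarrow> ('i \<times> 'a set) set" where
  "flag_at J g = (\<lambda>i. (i, g <#\<^bsub>G\<^esub> H i)) ` J"

text \<open>The stabilizer of the flag \<open>flag_at J \<one>\<close>.\<close>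

definition stabilizer_of :: "'i set \<Rightarrow> 'a set" where
  "stabilizer_of J = carrier G \<inter> (\<Inter>i\<in>J. H i)"

lemma mem_coset: "i \<in> I \<Longrightarrow> g \<in> carrier G \<Longrightarrow> g \<in> g <#\<^bsub>G\<^esub> H i"
  using subgroup.one_closed[OF subgroups[of i]] by (force simp: l_coset_def)

lemma coset_eq:
  "x \<in> g <#\<^bsub>G\<^esub> H i \<Longrightarrow> g \<in> carrier G \<Longrightarrow> i \<in> I \<Longrightarrow> g <#\<^bsub>G\<^esub> H i = x <#\<^bsub>G\<^esub> H i"
  by (rule l_repr_independence) (auto intro: subgroups)

lemma coset_subset: "i \<in> I \<Longrightarrow> g \<in> carrier G \<Longrightarrow> g <#\<^bsub>G\<^esub> H i \<subseteq> carrier G"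
  by (rule l_coset_subset_G) (auto dest: subgroup.subset[OF subgroups])

lemma mem_coset_iff:
  assumes "i \<in> I" "g \<in> carrier G" "x \<in> carrier G"
  shows "x \<in> g <#\<^bsub>G\<^esub> H i \<longleftrightarrow> inv g \<otimes> x \<in> H i"
proof
  assume "x \<in> g <#\<^bsub>G\<^esub> H i"
  then obtain h where "h \<in> H i" "x = g \<otimes> h" by (auto simp: l_coset_def)
  moreover from this have "h \<in> carrier G"
    using subgroup.mem_carrier[OF subgroups[OF assms(1)]] by blast
  ultimately show "inv g \<otimes> x \<in> H i" using assms by (simp add: m_assoc[symmetric])
next
  assume "inv g \<otimes> x \<in> H i"
  moreover have "x = g \<otimes> (inv g \<otimes> x)" using assms by (simp add: m_assoc[symmetric])
  ultimately show "x \<in> g <#\<^bsub>G\<^esub> H i" unfolding l_coset_def by blast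
qed

lemma coset_eq_iff:
  assumes "i \<in> I" "g \<in> carrier G" "x \<in> carrier G"
  shows "g <#\<^bsub>G\<^esub> H i = x <#\<^bsub>G\<^esub> H i \<longleftrightarrow> inv g \<otimes> x \<in> H i"
  using assms mem_coset_iff[OF assms] coset_eq mem_coset by metis

lemma cosets_simps [simp]:
  "type_set cosets = I"
  "elements cosets = {(i, g <#\<^bsub>G\<^esub> H i) | i g. i \<in> I \<and> g \<in> carrier G}"
  "type_map cosets = fst"
  "incident cosets x y \<longleftrightarrow> snd x \<inter> snd y \<noteq> {}"
  by (simp_all add: coset_incidence_system_def)

lemma element_eqI:
  assumes "x \<in> elements cosets" "y \<in> elements cosets" "incident cosets x y" "fst x = fst y"
  shows "x = y"
proof -
  obtain i g where x: "x = (i, g <#\<^bsub>G\<^esub> H i)" "i \<in> I" "g \<in> carrier G"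
    using assms(1) by auto
  obtain j k where y: "y = (j, k <#\<^bsub>G\<^esub> H j)" "j \<in> I" "k \<in> carrier G"
    using assms(2) by auto
  have j: "j = i" using assms(4) x(1) y(1) by simp
  have "(g <#\<^bsub>G\<^esub> H i) \<inter> (k <#\<^bsub>G\<^esub> H i) \<noteq> {}"
    using assms(3) unfolding x(1) y(1) j by simp
  then obtain z where z: "z \<in> g <#\<^bsub>G\<^esub> H i" "z \<in> k <#\<^bsub>G\<^esub> H i" by blast
  have "g <#\<^bsub>G\<^esub> H i = k <#\<^bsub>G\<^esub> H i"
    using coset_eq[OF z(1) x(3,2)] coset_eq[OF z(2) y(3) x(2)] by (rule trans[OF _ sym])
  then show ?thesis unfolding x(1) y(1) j by simp
qed

lemma incidence_system_cosets: "incidence_system cosets"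
  unfolding incidence_system_def
proof (intro conjI ballI impI)
  show "type_map cosets ` elements cosets \<subseteq> type_set cosets" by auto
next
  fix x assume "x \<in> elements cosets"
  then obtain i g where x: "x = (i, g <#\<^bsub>G\<^esub> H i)" "i \<in> I" "g \<in> carrier G" by auto
  then show "incident cosets x x" using mem_coset[OF x(2,3)] by auto
next
  fix x y assume "x \<in> elements cosets" "y \<in> elements cosets" "incident cosets x y"
  then show "incident cosets y x" by (simp add: Int_commute)
next
  fix x y assume "x \<in> elements cosets" "y \<in> elements cosets" "incident cosets x y \<and> x \<noteq> y"
  then show "type_map cosets x \<noteq> type_map cosets y" using element_eqI[of x y] unfolding cosets_simps(3) by blast
qed

lemma flag_flag_at:
  assumes "J \<subseteq> I" "g \<in> carrier G"
  shows "flag cosets (flag_at J g)" "flag_type cosets (flag_at J g) = J"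
proof -
  have "flag_at J g \<subseteq> elements cosets" using assms by (auto simp: flag_at_def)
  moreover have "g \<in> snd x" if "x \<in> flag_at J g" for x
    using that assms mem_coset[of _ g] by (auto simp: flag_at_def)
  ultimately show "flag cosets (flag_at J g)" unfolding flag_def cosets_simps by blast
  show "flag_type cosets (flag_at J g) = J"
    by (force simp: flag_type_def flag_at_def)
qed

lemma card_flag_at: "card (flag_at J g) = card J"
  unfolding flag_at_def by (rule card_image) (simp add: inj_on_def)

lemma flag_at_mult:
  assumes "J \<subseteq> I" "g \<in> carrier G" "k \<in> carrier G"
  shows "translate G g ` flag_at J k = flag_at J (g \<otimes> k)"
proof -
  have "g <#\<^bsub>G\<^esub> (k <#\<^bsub>G\<^esub> H i) = g \<otimes> k <#\<^bsub>G\<^esub> H i" if "i \<in> J" for i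
    using that assms subgroup.subset[OF subgroups] by (intro lcos_m_assoc) auto
  then show ?thesis by (simp add: flag_at_def translate_def image_image)
qed

lemma stabilizer_of_mult_coset:
  assumes "i \<in> I" "g \<in> carrier G" "u \<in> H i"
  shows "g \<otimes> u <#\<^bsub>G\<^esub> H i = g <#\<^bsub>G\<^esub> H i"
  using assms coset_eq[of "g \<otimes> u" g i] by (auto simp: l_coset_def)

end

text \<open>Flag-transitivity of a coset incidence system is a Helly property of the cosets: a pairwise
intersecting family must have a common element.\<close>

locale helly_family = subgroup_family G I H for G (structure) and I :: "'i set" and H +
  assumes helly:
    "J \<subseteq> I \<Longrightarrow> (\<And>i. i \<in> J \<Longrightarrow> f i \<in> carrier G) \<Longrightarrow>
     (\<And>i j. i \<in> J \<Longrightarrow> j \<in> J \<Longrightarrow> (f i <#\<^bsub>G\<^esub> H i) \<inter> (f j <#\<^bsub>G\<^esub> H j) \<noteq> {}) \<Longrightarrow>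
     \<exists>g\<in>carrier G. \<forall>i\<in>J. g \<in> f i <#\<^bsub>G\<^esub> H i"
begin

text \<open>The common element provided by the Helly property represents all cosets of the flag.\<close>

lemma flagE:
  assumes "flag cosets F"
  obtains g where "g \<in> carrier G" "flag_type cosets F \<subseteq> I" "F = flag_at (flag_type cosets F) g"
proof -
  define J where "J = flag_type cosets F"
  have el: "x \<in> elements cosets" if "x \<in> F" for x using assms that by (auto simp: flag_def)
  have types: "fst x \<in> I" if "x \<in> F" for x using el[OF that] by auto
  then have J: "J \<subseteq> I" by (auto simp: J_def flag_type_def)
  have "\<forall>i\<in>J. \<exists>k. k \<in> carrier G \<and> (i, k <#\<^bsub>G\<^esub> H i) \<in> F"
    using el by (fastforce simp: J_def flag_type_def)
  then obtain f where f: "\<And>i. i \<in> J \<Longrightarrow> f i \<in> carrier G \<and> (i, f i <#\<^bsub>G\<^esub> H i) \<in> F" by metis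
  have "\<exists>g\<in>carrier G. \<forall>i\<in>J. g \<in> f i <#\<^bsub>G\<^esub> H i"
  proof (rule helly[OF J])
    fix i j assume "i \<in> J" "j \<in> J"
    then have "incident cosets (i, f i <#\<^bsub>G\<^esub> H i) (j, f j <#\<^bsub>G\<^esub> H j)"
      using f assms unfolding flag_def by blast
    then show "(f i <#\<^bsub>G\<^esub> H i) \<inter> (f j <#\<^bsub>G\<^esub> H j) \<noteq> {}" by simp
  qed (use f in auto)
  then obtain g where g: "g \<in> carrier G" "\<And>i. i \<in> J \<Longrightarrow> g \<in> f i <#\<^bsub>G\<^esub> H i" by blast
  have eq: "f i <#\<^bsub>G\<^esub> H i = g <#\<^bsub>G\<^esub> H i" if "i \<in> J" for i
    using coset_eq[OF g(2)[OF that]] f[OF that] J that by blast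
  have "F = flag_at J g"
  proof
    show "flag_at J g \<subseteq> F" using f eq by (auto simp: flag_at_def)
    show "F \<subseteq> flag_at J g"
    proof
      fix x assume x: "x \<in> F"
      then have i: "fst x \<in> J" by (force simp: J_def flag_type_def)
      then have "x = (fst x, f (fst x) <#\<^bsub>G\<^esub> H (fst x))"
        using f[OF i] x assms el by (intro element_eqI) (auto simp: flag_def simp del: cosets_simps)
      then have "x = (fst x, g <#\<^bsub>G\<^esub> H (fst x))" using eq[OF i] by simp
      then show "x \<in> flag_at J g" unfolding flag_at_def using i by (rule image_eqI)
    qed
  qed
  then show thesis using that g(1) J unfolding J_def by blast
qed

lemma flags_of_type:
  assumes "J \<subseteq> I"
  shows "{F. flag cosets F \<and> flag_type cosets F = J} = flag_at J ` carrier G"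
proof (intro subset_antisym subsetI)
  fix F assume F: "F \<in> {F. flag cosets F \<and> flag_type cosets F = J}"
  then have "flag cosets F" by blast
  then obtain g where "g \<in> carrier G" "F = flag_at (flag_type cosets F) g" by (rule flagE)
  then show "F \<in> flag_at J ` carrier G" using F by blast
next
  fix F assume "F \<in> flag_at J ` carrier G"
  then show "F \<in> {F. flag cosets F \<and> flag_type cosets F = J}"
    using flag_flag_at[OF assms] by blast
qed

text \<open>A flag at \<open>g\<close> extends to the chamber at \<open>g\<close>, so a maximal flag is a chamber.\<close>

lemma incidence_geometry_cosets: "incidence_geometry cosets"
  unfolding incidence_geometry_def
proof (intro conjI allI impI)
  fix F assume F: "maximal_flag cosets F"
  then have fl: "flag cosets F" by (simp add: maximal_flag_def)
  then obtain g where g: "g \<in> carrier G" "flag_type cosets F \<subseteq> I"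
    "F = flag_at (flag_type cosets F) g" by (rule flagE)
  have "F \<subseteq> flag_at I g" using g(2) by (subst g(3)) (auto simp: flag_at_def)
  then have "flag_at I g = F" using F flag_flag_at(1)[OF subset_refl g(1)] by (simp add: maximal_flag_def)
  then show "chamber cosets F" using flag_flag_at[OF subset_refl g(1)] by (auto simp: chamber_def)
qed (rule incidence_system_cosets)

lemma acts_flag_transitively: "acts_flag_transitively G I H"
  unfolding acts_flag_transitively_def Let_def
proof (intro allI impI)
  fix J assume J: "J \<subseteq> I"
  let ?F = "flag_at J ` carrier G"
  let ?\<phi> = "\<lambda>g. \<lambda>F\<in>?F. translate G g ` F"
  have \<phi>: "?\<phi> g (flag_at J k) = flag_at J (g \<otimes> k)" if "g \<in> carrier G" "k \<in> carrier G" for g k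
    using flag_at_mult[OF J that] that by auto
  have bij: "?\<phi> g \<in> Bij ?F" if g: "g \<in> carrier G" for g
  proof -
    have "bij_betw (?\<phi> g) ?F ?F"
    proof (rule bij_betw_byWitness[where f' = "?\<phi> (inv g)"])
      show "\<forall>F\<in>?F. ?\<phi> (inv g) (?\<phi> g F) = F"
        using g by (auto simp: \<phi> m_assoc[symmetric] simp del: restrict_apply)
      show "\<forall>F\<in>?F. ?\<phi> g (?\<phi> (inv g) F) = F"
        using g by (auto simp: \<phi> m_assoc[symmetric] simp del: restrict_apply)
    qed (use g in \<open>auto simp: flag_at_mult[OF J]\<close>)
    then show ?thesis by (simp add: Bij_def)
  qed
  have "group_hom G (BijGroup ?F) ?\<phi>"
  proof (intro group_hom.intro group_hom_axioms.intro is_group group_BijGroup homI)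
    fix g k assume gk: "g \<in> carrier G" "k \<in> carrier G"
    have "?\<phi> (g \<otimes> k) = compose ?F (?\<phi> g) (?\<phi> k)"
    proof (rule extensionalityI[of _ ?F])
      fix F assume "F \<in> ?F"
      then show "?\<phi> (g \<otimes> k) F = compose ?F (?\<phi> g) (?\<phi> k) F"
        using gk by (auto simp: \<phi> compose_eq m_assoc simp del: restrict_apply)
    qed auto
    then show "?\<phi> (g \<otimes> k) = ?\<phi> g \<otimes>\<^bsub>BijGroup ?F\<^esub> ?\<phi> k"
      using bij[OF gk(1)] bij[OF gk(2)] by (simp add: BijGroup_def)
  qed (use bij in \<open>simp add: BijGroup_def\<close>)
  moreover have "\<exists>g\<in>carrier G. ?\<phi> g x = y" if x: "x \<in> ?F" and y: "y \<in> ?F" for x y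
  proof -
    obtain a where a: "a \<in> carrier G" "x = flag_at J a"
      using x by blast
    obtain b where b: "b \<in> carrier G" "y = flag_at J b"
      using y by blast
    have "?\<phi> (b \<otimes> inv a) x = y"
      unfolding a(2) b(2) using a(1) b(1) \<phi>[of "b \<otimes> inv a" a] by (simp only: m_assoc m_closed inv_closed l_inv r_one)
    then show ?thesis using a(1) b(1) by (intro bexI[of _ "b \<otimes> inv a"]) (simp_all only: m_closed inv_closed)
  qed
  ultimately show "transitive_action G {F. flag cosets F \<and> flag_type cosets F = J}
     (\<lambda>g. \<lambda>F\<in>{F. flag cosets F \<and> flag_type cosets F = J}. translate G g ` F)"
    unfolding flags_of_type[OF J]
    by (intro transitive_action.intro group_action.intro transitive_action_axioms.intro)
qed

text \<open>An element of the residue extends the flag to a larger flag, which sits at some group element. That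
element differs from \<open>g\<close> by an element of the stabilizer because both represent the original flag.\<close>

lemma residue_flag_at:
  assumes J: "J \<subseteq> I" and g: "g \<in> carrier G"
  shows "elements (residue cosets (flag_at J g)) =
    {(i, g \<otimes> u <#\<^bsub>G\<^esub> H i) | i u. i \<in> I - J \<and> u \<in> stabilizer_of J}" (is "?L = ?R")
proof
  show "?R \<subseteq> ?L"
  proof
    fix x assume "x \<in> ?R"
    then obtain i u where x: "x = (i, g \<otimes> u <#\<^bsub>G\<^esub> H i)" "i \<in> I - J" "u \<in> stabilizer_of J" by blast
    then have u: "u \<in> carrier G" by (simp add: stabilizer_of_def)
    have "flag_at J g = flag_at J (g \<otimes> u)"
      unfolding flag_at_def
    proof (rule image_cong[OF refl])
      fix j assume "j \<in> J"
      then show "(j, g <#\<^bsub>G\<^esub> H j) = (j, g \<otimes> u <#\<^bsub>G\<^esub> H j)"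
        using x stabilizer_of_mult_coset[of j g u] J g by (auto simp: stabilizer_of_def)
    qed
    moreover have "g \<otimes> u \<in> snd y" if "y \<in> flag_at J (g \<otimes> u)" for y
      using that mem_coset[of _ "g \<otimes> u"] J g u by (auto simp: flag_at_def)
    moreover have "g \<otimes> u \<in> snd x" using x g u mem_coset by simp
    moreover have "x \<notin> flag_at J g" using x by (auto simp: flag_at_def)
    ultimately show "x \<in> ?L" using x g u by (auto simp: residue_def)
  qed
  show "?L \<subseteq> ?R"
  proof
    fix x assume "x \<in> ?L"
    then have el: "x \<in> elements cosets" and nin: "x \<notin> flag_at J g"
      and inc: "\<And>y. y \<in> flag_at J g \<Longrightarrow> incident cosets x y" by (auto simp: residue_def)
    then obtain i k where x: "x = (i, k <#\<^bsub>G\<^esub> H i)" "i \<in> I" "k \<in> carrier G" by auto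
    have i: "i \<notin> J"
    proof
      assume iJ: "i \<in> J"
      then have "x = (i, g <#\<^bsub>G\<^esub> H i)"
        using x g inc[of "(i, g <#\<^bsub>G\<^esub> H i)"]
        by (intro element_eqI[OF el]) (auto simp: flag_at_def)
      then show False using nin iJ by (auto simp: flag_at_def)
    qed
    \<comment> \<open>The flag together with \<open>x\<close> is a flag, hence it sits at some group element \<open>k'\<close>.\<close>
    have "flag cosets (insert x (flag_at J g))"
      using flag_flag_at(1)[OF J g] el inc incidence_system_cosets
      unfolding flag_def incidence_system_def by (auto simp del: cosets_simps)
    moreover have "flag_type cosets (insert x (flag_at J g)) = insert i J"
      using flag_flag_at(2)[OF J g] x by (simp add: flag_type_def)
    ultimately obtain k' where k': "k' \<in> carrier G" "insert x (flag_at J g) = flag_at (insert i J) k'"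
      by (metis flagE)
    have "x \<in> flag_at (insert i J) k'" using k'(2) by blast
    then have xk: "x = (i, k' <#\<^bsub>G\<^esub> H i)" using x by (auto simp: flag_at_def)
    have "inv g \<otimes> k' \<in> stabilizer_of J"
    proof -
      have "inv g \<otimes> k' \<in> H j" if j: "j \<in> J" for j
      proof -
        have "(j, g <#\<^bsub>G\<^esub> H j) \<in> flag_at (insert i J) k'"
          using j k'(2) by (auto simp: flag_at_def)
        then have "g <#\<^bsub>G\<^esub> H j = k' <#\<^bsub>G\<^esub> H j" by (auto simp: flag_at_def)
        then show ?thesis using j J coset_eq_iff g k' by blast
      qed
      then show ?thesis using g k' by (simp add: stabilizer_of_def)
    qed
    moreover have "x = (i, g \<otimes> (inv g \<otimes> k') <#\<^bsub>G\<^esub> H i)"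
      using xk g k' by (simp add: m_assoc[symmetric])
    ultimately show "x \<in> ?R" using x i by blast
  qed
qed

text \<open>Elements \<open>g u H\<^sub>i\<close> and \<open>g u H\<^sub>j\<close> of a residue are incident. If \<open>s\<close> belongs to \<open>H\<^sub>k\<close>, then
\<open>g u H\<^sub>k = g u s H\<^sub>k\<close>, so one can pass from \<open>u\<close> to \<open>u s\<close> through the type \<open>k\<close>. Walking along a word in
generators of this kind connects any two elements.\<close>

lemma residually_connectedI:
  assumes gen: "\<And>J. J \<subseteq> I \<Longrightarrow> card (I - J) \<ge> 2 \<Longrightarrow>
    stabilizer_of J \<subseteq> generate G (\<Union>i\<in>I - J. stabilizer_of (insert i J))"
  shows "residually_connected cosets"
  unfolding residually_connected_def
proof (intro allI impI)
  fix F assume F: "flag cosets F \<and> 2 \<le> corank cosets F"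
  then have "flag cosets F" by blast
  then obtain g where g: "g \<in> carrier G" "flag_type cosets F \<subseteq> I"
    "F = flag_at (flag_type cosets F) g" by (rule flagE)
  define J where "J = flag_type cosets F"
  have J: "J \<subseteq> I" using g(2) by (simp add: J_def)
  have FJ: "F = flag_at J g" using g(3) unfolding J_def .
  have card: "card (I - J) \<ge> 2"
    using F J finite_types card_flag_at[of J g] by (simp add: corank_def FJ card_Diff_subset finite_subset)
  define E where "E = elements (residue cosets F)"
  have E: "E = {(i, g \<otimes> u <#\<^bsub>G\<^esub> H i) | i u. i \<in> I - J \<and> u \<in> stabilizer_of J}"
    unfolding E_def FJ by (rule residue_flag_at[OF J g(1)])
  have inc: "incident (residue cosets F) = incident cosets" by (simp add: residue_def)
  define R where "R = {(a, b). a \<in> E \<and> b \<in> E \<and> incident cosets a b}"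
  have sub: "subgroup (stabilizer_of K) G" if "K \<subseteq> I" for K
  proof (cases "K = {}")
    case True then show ?thesis by (simp add: stabilizer_of_def subgroup_self)
  next
    case False
    then have inter: "subgroup (\<Inter> (H ` K)) G"
      using that subgroups by (intro subgroups_Inter) auto
    then have "stabilizer_of K = \<Inter> (H ` K)"
      unfolding stabilizer_of_def by (rule Int_absorb1[OF subgroup.subset])
    then show ?thesis using inter by simp
  qed
  have same: "((i, g \<otimes> u <#\<^bsub>G\<^esub> H i), (j, g \<otimes> u <#\<^bsub>G\<^esub> H j)) \<in> R"
    if "i \<in> I - J" "j \<in> I - J" "u \<in> stabilizer_of J" for i j u
  proof -
    have "g \<otimes> u \<in> carrier G" using that g by (simp add: stabilizer_of_def)
    then have "g \<otimes> u \<in> (g \<otimes> u <#\<^bsub>G\<^esub> H i) \<inter> (g \<otimes> u <#\<^bsub>G\<^esub> H j)" using that mem_coset by blast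
    moreover have "(i, g \<otimes> u <#\<^bsub>G\<^esub> H i) \<in> E" "(j, g \<otimes> u <#\<^bsub>G\<^esub> H j) \<in> E"
      using that unfolding E by blast+
    ultimately show ?thesis by (simp add: R_def) blast
  qed
  have step: "u \<in> stabilizer_of J \<Longrightarrow> i \<in> I - J \<Longrightarrow> j \<in> I - J \<Longrightarrow>
      ((i, g \<otimes> u <#\<^bsub>G\<^esub> H i), (j, g \<otimes> (u \<otimes> s) <#\<^bsub>G\<^esub> H j)) \<in> R\<^sup>*"
    if "s \<in> generate G (\<Union>i\<in>I - J. stabilizer_of (insert i J))" for s u i j
    using that
  proof (induction arbitrary: u i j rule: generate.induct)
    case one
    then have "u \<otimes> \<one> = u" by (simp add: stabilizer_of_def)
    then show ?case using same[OF one(2,3,1)] by simp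
  next
    case (incl h)
    then obtain k where k: "k \<in> I - J" "h \<in> stabilizer_of (insert k J)" by blast
    then have hJ: "h \<in> stabilizer_of J" "h \<in> H k" by (auto simp: stabilizer_of_def)
    have uh: "u \<otimes> h \<in> stabilizer_of J"
      using incl hJ sub[OF J] by (simp add: subgroup.m_closed)
    have "g \<otimes> (u \<otimes> h) <#\<^bsub>G\<^esub> H k = g \<otimes> u <#\<^bsub>G\<^esub> H k"
      using k hJ g incl stabilizer_of_mult_coset[of k "g \<otimes> u" h]
      by (simp add: stabilizer_of_def m_assoc)
    then show ?case
      using same[OF incl(3) k(1) incl(2)] same[OF k(1) incl(4) uh] by simp
  next
    case (inv h)
    then obtain k where k: "k \<in> I - J" "h \<in> stabilizer_of (insert k J)" by blast
    then have "inv h \<in> stabilizer_of (insert k J)"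
      using sub[of "insert k J"] J by (simp add: subgroup.m_inv_closed)
    then have hJ: "inv h \<in> stabilizer_of J" "inv h \<in> H k" by (auto simp: stabilizer_of_def)
    have uh: "u \<otimes> inv h \<in> stabilizer_of J"
      using inv hJ sub[OF J] by (simp add: subgroup.m_closed)
    have "g \<otimes> (u \<otimes> inv h) <#\<^bsub>G\<^esub> H k = g \<otimes> u <#\<^bsub>G\<^esub> H k"
      using k hJ g inv stabilizer_of_mult_coset[of k "g \<otimes> u" "inv h"]
      by (simp add: stabilizer_of_def m_assoc)
    then show ?case
      using same[OF inv(3) k(1) inv(2)] same[OF k(1) inv(4) uh] by simp
  next
    case (eng s t)
    have gen_sub: "generate G (\<Union>i\<in>I - J. stabilizer_of (insert i J)) \<subseteq> stabilizer_of J"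
      by (rule generate_subgroup_incl[OF _ sub[OF J]]) (auto simp: stabilizer_of_def)
    have us: "u \<otimes> s \<in> stabilizer_of J"
      using eng gen_sub sub[OF J] by (auto intro: subgroup.m_closed)
    have "s \<in> carrier G" "t \<in> carrier G" "u \<in> carrier G"
      using eng gen_sub by (auto simp: stabilizer_of_def)
    then have "u \<otimes> s \<otimes> t = u \<otimes> (s \<otimes> t)" by (simp add: m_assoc)
    then show ?case
      using eng.IH(1)[OF eng.prems(1,2,2)] eng.IH(2)[OF us eng.prems(2,3)] by (simp add: rtrancl_trans)
  qed
  have "(x, y) \<in> R\<^sup>*" if "x \<in> E" "y \<in> E" for x y
  proof -
    obtain i u where x: "x = (i, g \<otimes> u <#\<^bsub>G\<^esub> H i)" "i \<in> I - J" "u \<in> stabilizer_of J"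
      using \<open>x \<in> E\<close> by (auto simp: E)
    obtain j v where y: "y = (j, g \<otimes> v <#\<^bsub>G\<^esub> H j)" "j \<in> I - J" "v \<in> stabilizer_of J"
      using \<open>y \<in> E\<close> by (auto simp: E)
    have "inv u \<otimes> v \<in> stabilizer_of J"
      using x y sub[OF J] by (simp add: subgroup.m_closed subgroup.m_inv_closed)
    then have "inv u \<otimes> v \<in> generate G (\<Union>i\<in>I - J. stabilizer_of (insert i J))"
      using gen[OF J card] by blast
    moreover have "u \<otimes> (inv u \<otimes> v) = v"
      using x y by (simp add: stabilizer_of_def m_assoc[symmetric])
    ultimately show ?thesis using step[of "inv u \<otimes> v" u i j] x y by simp
  qed
  moreover have "E \<noteq> {}"
  proof -
    have "I - J \<noteq> {}" using card by force
    then obtain i where "i \<in> I - J" by blast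
    moreover have "\<one> \<in> stabilizer_of J" using sub[OF J] by (rule subgroup.one_closed)
    ultimately show ?thesis by (auto simp: E)
  qed
  ultimately show "incidence_connected (residue cosets F)"
    unfolding incidence_connected_def inc E_def[symmetric] R_def[symmetric] by blast
qed

text \<open>Translation by \<open>g\<close> identifies the residue of the flag of type \<open>I - {i}\<close> at \<open>g\<close> with the one at
\<open>\<one>\<close>, so a property of the sizes of these residues has to be checked only once for each type.\<close>

lemma corank_one_residues:
  "(\<forall>F. flag cosets F \<and> corank cosets F = 1 \<longrightarrow> P (card (elements (residue cosets F)))) \<longleftrightarrow>
   (\<forall>i\<in>I. P (card ((\<lambda>u. u <#\<^bsub>G\<^esub> H i) ` stabilizer_of (I - {i}))))"
proof -
  have res: "card (elements (residue cosets (flag_at (I - {i}) g))) =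
      card ((\<lambda>u. u <#\<^bsub>G\<^esub> H i) ` stabilizer_of (I - {i}))"
    if i: "i \<in> I" and g: "g \<in> carrier G" for i g
  proof -
    let ?A = "(\<lambda>u. u <#\<^bsub>G\<^esub> H i) ` stabilizer_of (I - {i})"
    have assoc: "g <#\<^bsub>G\<^esub> (u <#\<^bsub>G\<^esub> H i) = g \<otimes> u <#\<^bsub>G\<^esub> H i" if "u \<in> stabilizer_of (I - {i})" for u
      using that g i subgroup.subset[OF subgroups] by (intro lcos_m_assoc) (auto simp: stabilizer_of_def)
    have "elements (residue cosets (flag_at (I - {i}) g)) = (\<lambda>C. (i, g <#\<^bsub>G\<^esub> C)) ` ?A"
      using residue_flag_at[of "I - {i}" g] i g assoc by (auto simp: image_image)
    moreover have "inj_on (\<lambda>C. (i, g <#\<^bsub>G\<^esub> C)) ?A"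
    proof (rule inj_on_inverseI[of _ "\<lambda>(i, C). inv g <#\<^bsub>G\<^esub> C"])
      fix C assume "C \<in> ?A"
      then have "C \<subseteq> carrier G" using i coset_subset by (auto simp: stabilizer_of_def)
      then show "(\<lambda>(i, C). inv g <#\<^bsub>G\<^esub> C) (i, g <#\<^bsub>G\<^esub> C) = C"
        using g by (simp add: lcos_m_assoc lcos_mult_one)
    qed
    ultimately show ?thesis by (simp add: card_image)
  qed
  show ?thesis
  proof (intro iffI ballI allI impI)
    fix i assume i: "i \<in> I"
      and P: "\<forall>F. flag cosets F \<and> corank cosets F = 1 \<longrightarrow> P (card (elements (residue cosets F)))"
    have "I - {i} \<subseteq> I" by blast
    then have "flag cosets (flag_at (I - {i}) \<one>)" by (rule flag_flag_at) simp
    moreover have "corank cosets (flag_at (I - {i}) \<one>) = 1"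
      using i finite_types card_Suc_Diff1[OF finite_types i] by (simp add: corank_def card_flag_at)
    ultimately show "P (card ((\<lambda>u. u <#\<^bsub>G\<^esub> H i) ` stabilizer_of (I - {i})))"
      using P res[OF i one_closed] by metis
  next
    fix F assume F: "flag cosets F \<and> corank cosets F = 1"
      and P: "\<forall>i\<in>I. P (card ((\<lambda>u. u <#\<^bsub>G\<^esub> H i) ` stabilizer_of (I - {i})))"
    from F have "flag cosets F" by blast
    then obtain g where g: "g \<in> carrier G" "flag_type cosets F \<subseteq> I"
      "F = flag_at (flag_type cosets F) g" by (rule flagE)
    have "card F = card (flag_type cosets F)" by (subst g(3)) (rule card_flag_at)
    then have "card (I - flag_type cosets F) = 1"
      using F g(2) finite_types by (simp add: corank_def card_Diff_subset finite_subset)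
    then obtain i where "I - flag_type cosets F = {i}" by (rule card_1_singletonE)
    then have i: "i \<in> I" and type: "flag_type cosets F = I - {i}" using g(2) by auto
    have F': "F = flag_at (I - {i}) g" using g(3) unfolding type .
    show "P (card (elements (residue cosets F)))"
      unfolding F' res[OF i g(1)] using P i by blast
  qed
qed

end

section \<open>Pattern groups\<close>

lemma entry_mult:
  assumes "g \<in> carrier_mat n n" "h \<in> carrier_mat n n" "i \<in> {1..n}" "j \<in> {1..n}"
  shows "entry (g * h) i j = (\<Sum>k\<in>{1..n}. entry g i k * entry h k j)"
proof -
  have "entry (g * h) i j = (\<Sum>k\<in>{0..<n}. g $$ (i - 1, k) * h $$ (k, j - 1))"
    using assms by (auto simp: entry_def scalar_prod_def intro!: sum.cong)
  also have "\<dots> = (\<Sum>k\<in>{1..n}. entry g i k * entry h k j)"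
    by (rule sum.reindex_bij_witness[of _ "\<lambda>k. k - 1" Suc]) (auto simp: entry_def)
  finally show ?thesis .
qed

lemma mat_eq_entryI:
  assumes "g \<in> carrier_mat n n" "h \<in> carrier_mat n n"
    "\<And>i j. i \<in> {1..n} \<Longrightarrow> j \<in> {1..n} \<Longrightarrow> entry g i j = entry h i j"
  shows "g = h"
proof (rule eq_matI)
  fix i j assume "i < dim_row h" "j < dim_col h"
  then show "g $$ (i, j) = h $$ (i, j)"
    using assms(1,2) assms(3)[of "Suc i" "Suc j"] by (simp add: entry_def)
qed (use assms in auto)

lemma entry_one: "i \<in> {1..n} \<Longrightarrow> j \<in> {1..n} \<Longrightarrow> entry (1\<^sub>m n) i j = (if i = j then 1 else 0)"
  by (auto simp: entry_def)

lemma elem_unitriangular_carrier [simp]: "elem_unitriangular n d t \<in> carrier_mat n n"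
  by (simp add: elem_unitriangular_def)

lemma elem_unitriangular_mult_carrier [simp]:
  fixes t :: "'a::field"
  shows "g \<in> carrier_mat n k \<Longrightarrow> elem_unitriangular n d t * g \<in> carrier_mat n k"
  by (rule mult_carrier_mat[OF elem_unitriangular_carrier])

lemma entry_elem_unitriangular:
  assumes "i \<in> {1..n}" "j \<in> {1..n}"
  shows "entry (elem_unitriangular n d t) i j = (if i = j then 1 else if (i, j) = d then t else 0)"
  using assms by (auto simp: entry_def elem_unitriangular_def)

lemma mult_pattern_group [simp]:
  "g \<otimes>\<^bsub>pattern_group n S\<^esub> h = g * h" "\<one>\<^bsub>pattern_group n S\<^esub> = 1\<^sub>m n"
  by (simp_all add: pattern_group_def UT_def)

lemma pattern_group_carrier_iff:
  "g \<in> carrier (pattern_group n S) \<longleftrightarrow> g \<in> carrier_mat n n \<and>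
    (\<forall>i\<in>{1..n}. \<forall>j\<in>{1..n}. (i = j \<longrightarrow> entry g i j = 1) \<and>
      (i \<noteq> j \<and> (i, j) \<notin> S \<inter> Delta n \<longrightarrow> entry g i j = 0))"
proof (cases "g \<in> carrier_mat n n")
  case False
  then show ?thesis by (simp add: pattern_group_def UT_def)
next
  case g: True
  have "upper_triangular g \<longleftrightarrow> (\<forall>i\<in>{1..n}. \<forall>j\<in>{1..n}. j < i \<longrightarrow> entry g i j = 0)"
  proof
    show "upper_triangular g" if *: "\<forall>i\<in>{1..n}. \<forall>j\<in>{1..n}. j < i \<longrightarrow> entry g i j = 0"
    proof (rule upper_triangularI)
      fix i j assume "j < i" "i < dim_row g"
      then show "g $$ (i, j) = 0" using g *[rule_format, of "Suc i" "Suc j"] by (simp add: entry_def)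
    qed
  qed (use g in \<open>auto simp: entry_def upper_triangular_def\<close>)
  then have mem: "g \<in> carrier (pattern_group n S) \<longleftrightarrow>
      (\<forall>i\<in>{1..n}. \<forall>j\<in>{1..n}. j < i \<longrightarrow> entry g i j = 0) \<and> (\<forall>i\<in>{1..n}. entry g i i = 1) \<and>
      (\<forall>d\<in>Delta n - S. entry g (fst d) (snd d) = 0)"
    using g by (simp add: pattern_group_def UT_def case_prod_beta)
  show ?thesis
  proof
    assume L: "g \<in> carrier (pattern_group n S)"
    have "entry g i j = 0"
      if "i \<in> {1..n}" "j \<in> {1..n}" "i \<noteq> j" "(i, j) \<notin> S \<inter> Delta n" for i j
    proof (cases "j < i")
      case True then show ?thesis using L that unfolding mem by blast
    next
      case False
      then have "(i, j) \<in> Delta n - S" using that by (auto simp: Delta_def)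
      moreover have "\<forall>d\<in>Delta n - S. entry g (fst d) (snd d) = 0" using L unfolding mem by (elim conjE)
      ultimately have "entry g (fst (i, j)) (snd (i, j)) = 0" by (rule bspec[rotated])
      then show ?thesis by simp
    qed
    then show "g \<in> carrier_mat n n \<and> (\<forall>i\<in>{1..n}. \<forall>j\<in>{1..n}. (i = j \<longrightarrow> entry g i j = 1) \<and>
      (i \<noteq> j \<and> (i, j) \<notin> S \<inter> Delta n \<longrightarrow> entry g i j = 0))"
      using L g unfolding mem by blast
  next
    assume R: "g \<in> carrier_mat n n \<and> (\<forall>i\<in>{1..n}. \<forall>j\<in>{1..n}. (i = j \<longrightarrow> entry g i j = 1) \<and>
      (i \<noteq> j \<and> (i, j) \<notin> S \<inter> Delta n \<longrightarrow> entry g i j = 0))"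
    have "entry g i j = 0" if "i \<in> {1..n}" "j \<in> {1..n}" "j < i" for i j
    proof -
      have "(i, j) \<notin> Delta n" "i \<noteq> j" using that by (auto simp: Delta_def)
      then show ?thesis using R that by blast
    qed
    moreover have "entry g (fst d) (snd d) = 0" if d: "d \<in> Delta n - S" for d
    proof -
      have "fst d \<in> {1..n}" "snd d \<in> {1..n}" "fst d \<noteq> snd d" "(fst d, snd d) \<notin> S \<inter> Delta n"
        using d by (auto simp: Delta_def)
      then show ?thesis using R by blast
    qed
    ultimately show "g \<in> carrier (pattern_group n S)" unfolding mem using R by blast
  qed
qed

lemma pattern_groupI:
  assumes "g \<in> carrier_mat n n" "\<And>i. i \<in> {1..n} \<Longrightarrow> entry g i i = 1"
    "\<And>i j. i \<in> {1..n} \<Longrightarrow> j \<in> {1..n} \<Longrightarrow> i \<noteq> j \<Longrightarrow> (i, j) \<notin> S \<inter> Delta n \<Longrightarrow> entry g i j = 0"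
  shows "g \<in> carrier (pattern_group n S)"
  unfolding pattern_group_carrier_iff using assms by blast

lemma pattern_groupD:
  assumes "g \<in> carrier (pattern_group n S)"
  shows "g \<in> carrier_mat n n" "\<And>i. i \<in> {1..n} \<Longrightarrow> entry g i i = 1"
    "\<And>i j. i \<in> {1..n} \<Longrightarrow> j \<in> {1..n} \<Longrightarrow> i \<noteq> j \<Longrightarrow> (i, j) \<notin> S \<inter> Delta n \<Longrightarrow> entry g i j = 0"
  using assms unfolding pattern_group_carrier_iff by blast+

lemma pattern_group_mono:
  "S' \<subseteq> S \<Longrightarrow> carrier (pattern_group n S') \<subseteq> carrier (pattern_group n S)"
  by (auto intro!: pattern_groupI dest: pattern_groupD)

lemma elem_unitriangular_mem:
  "d \<in> S \<Longrightarrow> d \<in> Delta n \<Longrightarrow> elem_unitriangular n d t \<in> carrier (pattern_group n S)"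
  by (rule pattern_groupI) (auto simp: entry_elem_unitriangular)

lemma entry_elem_mult:
  fixes t :: "'a::field"
  assumes "(a, b) \<in> Delta n" "g \<in> carrier_mat n n" "i \<in> {1..n}" "j \<in> {1..n}"
  shows "entry (elem_unitriangular n (a, b) t * g) i j =
    entry g i j + (if i = a then t * entry g b j else 0)"
proof -
  let ?e = "\<lambda>k. entry (elem_unitriangular n (a, b) t) i k * entry g k j"
  have "(\<Sum>k\<in>{1..n}. ?e k) =
      (\<Sum>k\<in>{1..n}. (if k = i then entry g i j else 0) + (if k = b then if i = a then t * entry g b j else 0 else 0))"
    using assms by (intro sum.cong refl) (auto simp: entry_elem_unitriangular Delta_def)
  also have "\<dots> = entry g i j + (if i = a then t * entry g b j else 0)"
    using assms by (simp add: sum.distrib Delta_def)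
  finally show ?thesis unfolding entry_mult[OF elem_unitriangular_carrier assms(2-4)] .
qed

lemma elem_unitriangular_zero [simp]: "elem_unitriangular n d 0 = 1\<^sub>m n"
  by (rule mat_eq_entryI[where n = n]) (auto simp: entry_elem_unitriangular entry_one)

lemma elem_unitriangular_add:
  fixes s t :: "'a::field"
  assumes "d \<in> Delta n"
  shows "elem_unitriangular n d s * elem_unitriangular n d t = elem_unitriangular n d (s + t)"
proof -
  obtain a b where d: "d = (a, b)" by force
  show ?thesis
    by (rule mat_eq_entryI[where n = n])
      (use assms in \<open>auto simp: d entry_elem_mult entry_elem_unitriangular Delta_def\<close>)
qed

text \<open>This is the commutator relation of root elements: the last two factors are the inverses of the first
two.\<close>

lemma elem_unitriangular_commutator:
  fixes s t :: "'a::field"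
  assumes "(i, j) \<in> Delta n" "(j, k) \<in> Delta n"
  shows "elem_unitriangular n (i, j) s * (elem_unitriangular n (j, k) t *
      (elem_unitriangular n (i, j) (- s) * elem_unitriangular n (j, k) (- t))) =
    elem_unitriangular n (i, k) (s * t)"
  by (rule mat_eq_entryI[where n = n])
    (use assms in \<open>auto simp: entry_elem_mult entry_elem_unitriangular Delta_def\<close>)

text \<open>Gaussian elimination: clearing the entries row by row, starting with the lowest nontrivial row,
writes a matrix as a product of root elements whose positions all belong to the pattern.\<close>

lemma pattern_group_induct [consumes 2, case_names one elem]:
  assumes "closed_pattern n S" and "g \<in> carrier (pattern_group n S)"
    and one: "P (1\<^sub>m n)"
    and elem: "\<And>d t g. d \<in> S \<Longrightarrow> g \<in> carrier (pattern_group n S) \<Longrightarrow> P g \<Longrightarrow>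
      P (elem_unitriangular n d t * g)"
  shows "P g"
  using assms(2)
proof (induction "card {(i, j) \<in> S. entry g i j \<noteq> 0}" arbitrary: g rule: less_induct)
  case (less g)
  have S: "S \<subseteq> Delta n" "trans S" using assms(1) by (auto simp: closed_pattern_def)
  have finS: "finite S"
    by (rule finite_subset[OF S(1)], rule finite_subset[of _ "{1..n} \<times> {1..n}"]) (auto simp: Delta_def)
  define N where "N = {(i, j) \<in> S. entry g i j \<noteq> 0}"
  have finN: "finite N" unfolding N_def by (rule finite_subset[OF _ finS]) auto
  have g: "g \<in> carrier_mat n n" "\<And>i. i \<in> {1..n} \<Longrightarrow> entry g i i = 1"
    "\<And>i j. i \<in> {1..n} \<Longrightarrow> j \<in> {1..n} \<Longrightarrow> i \<noteq> j \<Longrightarrow> (i, j) \<notin> N \<Longrightarrow> entry g i j = 0"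
    using pattern_groupD[OF less.prems] by (auto simp: N_def)
  show ?case
  proof (cases "N = {}")
    case True
    then have "g = 1\<^sub>m n"
      using g by (intro mat_eq_entryI[where n = n]) (auto simp: entry_one)
    then show ?thesis using one by simp
  next
    case False
    define i where "i = Max (fst ` N)"
    have "i \<in> fst ` N" using False finN by (simp add: i_def)
    then obtain j where ij: "(i, j) \<in> N" by force
    have max: "i' \<le> i" if "(i', j') \<in> N" for i' j'
      unfolding i_def using finN that by (force intro!: Max_ge)
    have D: "(i, j) \<in> Delta n" "(i, j) \<in> S" using ij S by (auto simp: N_def)
    \<comment> \<open>Row \<open>j\<close> lies below the last nontrivial row \<open>i\<close>, so adding a multiple of it to
      row \<open>i\<close> changes the entry at \<open>(i, j)\<close> only.\<close>
    have rowj: "entry g j k = (if k = j then 1 else 0)" if "k \<in> {1..n}" for k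
      using that g(2)[of j] g(3)[of j k] max[of j k] D by (auto simp: Delta_def)
    define t where "t = entry g i j"
    define g' where "g' = elem_unitriangular n (i, j) (- t) * g"
    have g': "g' \<in> carrier_mat n n" unfolding g'_def by (rule mult_carrier_mat[OF _ g(1)]) simp
    have ent: "entry g' i' j' = (if (i', j') = (i, j) then 0 else entry g i' j')"
      if "i' \<in> {1..n}" "j' \<in> {1..n}" for i' j'
      unfolding g'_def using D(1) g(1) that by (auto simp: entry_elem_mult rowj t_def)
    have "g' \<in> carrier (pattern_group n S)"
      using pattern_groupD[OF less.prems] g' D(1) by (intro pattern_groupI) (auto simp: ent Delta_def)
    moreover have "{(i, j) \<in> S. entry g' i j \<noteq> 0} \<subset> N"
    proof
      show "{(i, j) \<in> S. entry g' i j \<noteq> 0} \<subseteq> N"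
        using S(1) by (auto simp: N_def ent Delta_def split: if_splits)
      have "entry g' i j = 0" using D by (subst ent) (auto simp: Delta_def)
      then show "{(i, j) \<in> S. entry g' i j \<noteq> 0} \<noteq> N" using ij by blast
    qed
    then have "card {(i, j) \<in> S. entry g' i j \<noteq> 0} < card {(i, j) \<in> S. entry g i j \<noteq> 0}"
      using finN unfolding N_def by (intro psubset_card_mono)
    ultimately have "P (elem_unitriangular n (i, j) t * g')"
      using less.hyps elem D(2) by blast
    moreover have "elem_unitriangular n (i, j) t * g' = g"
    proof -
      have "elem_unitriangular n (i, j) t * g' =
          (elem_unitriangular n (i, j) t * elem_unitriangular n (i, j) (- t)) * g"
        unfolding g'_def by (rule assoc_mult_mat[of _ n n _ n _ n, symmetric]) (use g(1) in auto)
      also have "\<dots> = g" using D(1) g(1) by (simp add: elem_unitriangular_add)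
      finally show ?thesis .
    qed
    ultimately show ?thesis by simp
  qed
qed

lemma pattern_group_mult_closed:
  assumes "closed_pattern n S"
    and g: "g \<in> carrier (pattern_group n S)" and h: "h \<in> carrier (pattern_group n S)"
  shows "g * h \<in> carrier (pattern_group n S)"
proof -
  have c: "g \<in> carrier_mat n n" "h \<in> carrier_mat n n" using g h by (auto dest: pattern_groupD)
  have z: "entry g i k * entry h k j = 0"
    if "i \<in> {1..n}" "j \<in> {1..n}" "k \<in> {1..n}" "(i, j) \<notin> S \<inter> Delta n" "\<not> (i = k \<and> k = j)" for i j k
  proof -
    have "i = k \<or> k = j \<or> \<not> ((i, k) \<in> S \<inter> Delta n \<and> (k, j) \<in> S \<inter> Delta n)"
      using assms(1) that unfolding closed_pattern_def trans_def by blast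
    then show ?thesis using that pattern_groupD(3)[OF g] pattern_groupD(3)[OF h] by auto
  qed
  show ?thesis
  proof (rule pattern_groupI)
    show "g * h \<in> carrier_mat n n" using c by (rule mult_carrier_mat)
  next
    fix i assume i: "i \<in> {1..n}"
    have "(i, i) \<notin> S \<inter> Delta n" by (auto simp: Delta_def)
    then have "(\<Sum>k\<in>{1..n}. entry g i k * entry h k i) = (\<Sum>k\<in>{i}. entry g i k * entry h k i)"
      using i z[OF i i] by (intro sum.mono_neutral_right) auto
    then show "entry (g * h) i i = 1"
      using pattern_groupD(2)[OF g i] pattern_groupD(2)[OF h i] by (simp add: entry_mult[OF c i i])
  next
    fix i j assume ij: "i \<in> {1..n}" "j \<in> {1..n}" "i \<noteq> j" "(i, j) \<notin> S \<inter> Delta n"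
    show "entry (g * h) i j = 0"
      unfolding entry_mult[OF c ij(1,2)] using ij(3) z[OF ij(1,2) _ ij(4)] by (intro sum.neutral) auto
  qed
qed

lemma one_mem_pattern_group: "1\<^sub>m n \<in> carrier (pattern_group n S)"
  by (rule pattern_groupI) (auto simp: entry_one)

text \<open>Left inverses are obtained factor by factor, as the inverse of a root element is again a root element.\<close>

lemma group_pattern_group:
  assumes S: "closed_pattern n S"
  shows "group (pattern_group n S :: 'a::field mat monoid)"
proof (rule groupI)
  show "\<one>\<^bsub>pattern_group n S\<^esub> \<in> carrier (pattern_group n S)"
    by (auto intro: one_mem_pattern_group)
next
  fix x :: "'a mat" assume x: "x \<in> carrier (pattern_group n S)"
  show "\<one>\<^bsub>pattern_group n S\<^esub> \<otimes>\<^bsub>pattern_group n S\<^esub> x = x"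
    using pattern_groupD(1)[OF x] by simp
  show "\<exists>y\<in>carrier (pattern_group n S). y \<otimes>\<^bsub>pattern_group n S\<^esub> x = \<one>\<^bsub>pattern_group n S\<^esub>"
    using S x
  proof (induction rule: pattern_group_induct)
    case one
    have "1\<^sub>m n \<in> carrier (pattern_group n S)" by (rule one_mem_pattern_group)
    then show ?case by (intro bexI[of _ "1\<^sub>m n"]) simp_all
  next
    case (elem d t g)
    have d: "d \<in> Delta n" using S elem(1) by (auto simp: closed_pattern_def)
    obtain y where y: "y \<in> carrier (pattern_group n S)" "y * g = 1\<^sub>m n" using elem(3) by auto
    have c: "y \<in> carrier_mat n n" "g \<in> carrier_mat n n"
      using y elem(2) by (auto dest: pattern_groupD)
    let ?e = "elem_unitriangular n d t" and ?f = "elem_unitriangular n d (- t)"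
    have "(y * ?f) * (?e * g) = y * (?f * (?e * g))"
      by (rule assoc_mult_mat[of _ n n _ n _ n]) (use c in auto)
    also have "?f * (?e * g) = (?f * ?e) * g"
      by (rule assoc_mult_mat[of _ n n _ n _ n, symmetric]) (use c in auto)
    also have "\<dots> = g" using d c by (simp add: elem_unitriangular_add)
    finally have "(y * ?f) * (?e * g) = 1\<^sub>m n" using y by simp
    moreover have "y * ?f \<in> carrier (pattern_group n S)"
      by (intro pattern_group_mult_closed[OF S] y elem_unitriangular_mem elem d)
    ultimately show ?case by (intro bexI[of _ "y * ?f"]) simp_all
  qed
next
  fix x y z :: "'a mat"
  assume "x \<in> carrier (pattern_group n S)" "y \<in> carrier (pattern_group n S)"
    "z \<in> carrier (pattern_group n S)"
  then show "x \<otimes>\<^bsub>pattern_group n S\<^esub> y \<otimes>\<^bsub>pattern_group n S\<^esub> z =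
      x \<otimes>\<^bsub>pattern_group n S\<^esub> (y \<otimes>\<^bsub>pattern_group n S\<^esub> z)"
    by (auto dest!: pattern_groupD(1) intro!: assoc_mult_mat)
qed (simp add: pattern_group_mult_closed[OF S])

lemma subgroup_pattern_group:
  assumes S: "closed_pattern n S" and S': "closed_pattern n S'" "S' \<subseteq> S"
  shows "subgroup (carrier (pattern_group n S')) (pattern_group n S)"
proof -
  interpret U: group "pattern_group n S" by (rule group_pattern_group[OF S])
  interpret V: group "pattern_group n S'" by (rule group_pattern_group[OF S'(1)])
  have sub: "carrier (pattern_group n S') \<subseteq> carrier (pattern_group n S)"
    by (rule pattern_group_mono[OF S'(2)])
  show ?thesis
  proof (rule U.subgroupI)
    show "carrier (pattern_group n S') \<noteq> {}" using V.one_closed by blast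
    fix a assume a: "a \<in> carrier (pattern_group n S')"
    have "inv\<^bsub>pattern_group n S\<^esub> a = inv\<^bsub>pattern_group n S'\<^esub> a"
      using V.l_inv[OF a] V.inv_closed[OF a] a sub by (intro U.inv_equality) auto
    then show "inv\<^bsub>pattern_group n S\<^esub> a \<in> carrier (pattern_group n S')"
      using V.inv_closed[OF a] by simp
  qed (use sub pattern_group_mult_closed[OF S'(1)] in auto)
qed

lemma inv_elem_unitriangular:
  fixes t :: "'a::field"
  assumes S: "closed_pattern n S" and d: "d \<in> S"
  shows "inv\<^bsub>pattern_group n S\<^esub> (elem_unitriangular n d t) = elem_unitriangular n d (- t)"
proof -
  interpret U: group "pattern_group n S :: 'a mat monoid" by (rule group_pattern_group[OF S])
  have "d \<in> Delta n" using S d by (auto simp: closed_pattern_def)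
  then show ?thesis
    using d by (intro U.inv_equality elem_unitriangular_mem) (auto simp: elem_unitriangular_add)
qed

text \<open>For \<open>d \<in> K\<close>, the \<open>t\<close> whose root element at \<open>d\<close> lies in the generated subgroup form an additive
subgroup of the field that contains a basis over the prime field, hence they exhaust the field. By
the commutator relation, the positions at which this happens form a transitive relation.\<close>

lemma generate_pattern_group:
  fixes T :: "'a::{field,finite} set"
  assumes S: "closed_pattern n S" and K: "K \<subseteq> S" and T: "prime_field_basis T"
  shows "generate (pattern_group n S) {elem_unitriangular n d t | t d. t \<in> T \<and> d \<in> K} =
    carrier (pattern_group n (K\<^sup>+))" (is "generate ?U ?X = _")
proof -
  interpret U: group ?U by (rule group_pattern_group[OF S])
  have Sp: "S \<subseteq> Delta n" "trans S" using S by (auto simp: closed_pattern_def)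
  have KS: "K\<^sup>+ \<subseteq> S" using trancl_mono_subset[OF K] trancl_id[OF Sp(2)] by simp
  have K': "closed_pattern n (K\<^sup>+)" using KS Sp by (auto simp: closed_pattern_def)
  have D: "d \<in> Delta n" if "d \<in> K\<^sup>+" for d using that KS Sp by blast
  have X: "?X \<subseteq> carrier ?U" using K Sp by (auto intro!: elem_unitriangular_mem)
  interpret X: subgroup "generate ?U ?X" ?U by (rule U.generate_is_subgroup[OF X])
  have base: "elem_unitriangular n d t \<in> generate ?U ?X" if d: "d \<in> K" for d t
  proof -
    have dD: "d \<in> Delta n" using d K Sp by blast
    define A where "A = {t. elem_unitriangular n d t \<in> generate ?U ?X}"
    have zero: "0 \<in> A" using X.one_closed by (simp add: A_def)
    have add: "s + t \<in> A" if "s \<in> A" "t \<in> A" for s t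
      using that X.m_closed[of "elem_unitriangular n d s" "elem_unitriangular n d t"]
      by (simp add: A_def elem_unitriangular_add[OF dD])
    have minus: "- t \<in> A" if "t \<in> A" for t
      using that X.m_inv_closed[of "elem_unitriangular n d t"] d K
      by (simp add: A_def inv_elem_unitriangular[OF S] subsetD)
    have nat: "of_nat k * t \<in> A" if "t \<in> A" for k t
      by (induction k) (use that zero add in \<open>auto simp: algebra_simps\<close>)
    have int: "of_int k * t \<in> A" if "t \<in> A" for k t
    proof (cases k)
      case (neg m)
      then have "of_int k * t = - (of_nat (Suc m) * t)"
        by (simp only: of_int_minus of_int_of_nat_eq mult_minus_left)
      then show ?thesis using minus[OF nat[OF that, of "Suc m"]] by simp
    qed (use nat that in simp)
    have TA: "t \<in> A" if "t \<in> T" for t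
      unfolding A_def using that d by (blast intro: generate.incl)
    have "(\<Sum>t\<in>Q. c t * t) \<in> A" if "finite Q" "Q \<subseteq> T" and c: "c \<in> T \<rightarrow> prime_subfield" for Q c
      using that(1,2)
    proof induction
      case (insert x Q)
      obtain k where "c x = of_int k" using c insert.prems by (auto simp: prime_subfield_def)
      then show ?case using insert add int[OF TA] by simp
    qed (simp add: zero)
    then have "t \<in> A" using T unfolding prime_field_basis_def by (metis finite subset_refl)
    then show ?thesis by (simp add: A_def)
  qed
  have root: "elem_unitriangular n d t \<in> generate ?U ?X" if "d \<in> K\<^sup>+" for d t
  proof -
    obtain i j where d: "d = (i, j)" by force
    have "(i, j) \<in> K\<^sup>+" using that d by simp
    then have "\<forall>t. elem_unitriangular n (i, j) t \<in> generate ?U ?X"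
    proof induction
      case (step j k)
      have D': "(i, j) \<in> Delta n" "(j, k) \<in> Delta n" using step D by blast+
      have m: "g * h \<in> generate ?U ?X" if "g \<in> generate ?U ?X" "h \<in> generate ?U ?X" for g h
        using X.m_closed[OF that] by simp
      show ?case
      proof
        fix t
        have "elem_unitriangular n (i, j) t * (elem_unitriangular n (j, k) 1 *
            (elem_unitriangular n (i, j) (- t) * elem_unitriangular n (j, k) (- 1))) \<in> generate ?U ?X"
          by (intro m step.IH[rule_format] base step.hyps(2))
        then show "elem_unitriangular n (i, k) t \<in> generate ?U ?X"
          by (simp add: elem_unitriangular_commutator[OF D'])
      qed
    qed (use base in blast)
    then show ?thesis by (simp add: d)
  qed
  show ?thesis
  proof
    show "generate ?U ?X \<subseteq> carrier (pattern_group n (K\<^sup>+))"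
      using D by (intro U.generate_subgroup_incl subgroup_pattern_group S K' KS)
        (auto intro!: elem_unitriangular_mem)
    show "carrier (pattern_group n (K\<^sup>+)) \<subseteq> generate ?U ?X"
    proof
      fix g :: "'a mat" assume "g \<in> carrier (pattern_group n (K\<^sup>+))"
      with K' show "g \<in> generate ?U ?X"
      proof (induction rule: pattern_group_induct)
        case one then show ?case using X.one_closed by simp
      next
        case (elem d t g)
        then show ?case using X.m_closed[OF root[of d t] elem(3)] by simp
      qed
    qed
  qed
qed

section \<open>Chains through a covering relation\<close>

locale pattern =
  fixes n :: nat and S :: "(nat \<times> nat) set"
  assumes closed: "closed_pattern n S"
begin

abbreviation less_pattern :: "nat \<Rightarrow> nat \<Rightarrow> bool" (infix "\<prec>" 50) where
  "i \<prec> j \<equiv> (i, j) \<in> S"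

abbreviation less_eq_pattern :: "nat \<Rightarrow> nat \<Rightarrow> bool" (infix "\<preceq>" 50) where
  "i \<preceq> j \<equiv> i = j \<or> (i, j) \<in> S"

definition covers :: "(nat \<times> nat) set" where
  "covers = covering_relations S"

text \<open>The pairs \<open>i \<prec> j\<close> that cannot be joined by a chain of covering relations other than \<open>c\<close>.\<close>

definition through :: "nat \<times> nat \<Rightarrow> (nat \<times> nat) set" where
  "through c = S - (covers - {c})\<^sup>+"

text \<open>The pairs that, for each \<open>c \<in> J\<close>, can be joined by a chain that does not use \<open>c\<close>.\<close>

definition avoiding :: "(nat \<times> nat) set \<Rightarrow> (nat \<times> nat) set" where
  "avoiding J = S - (\<Union>c\<in>J. through c)"

lemma less_imp: "i \<prec> j \<Longrightarrow> 1 \<le> i \<and> i < j \<and> j \<le> n"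
  using closed by (auto simp: closed_pattern_def Delta_def)

lemma in_Delta: "d \<in> S \<Longrightarrow> d \<in> Delta n"
  using closed by (auto simp: closed_pattern_def)

lemma less_eq_imp: "i \<preceq> j \<Longrightarrow> i \<le> j"
  using less_imp[of i j] by auto

lemma less_trans: "i \<prec> j \<Longrightarrow> j \<prec> k \<Longrightarrow> i \<prec> k"
  using closed unfolding closed_pattern_def trans_def by blast

lemma covers_subset: "covers \<subseteq> S"
  by (auto simp: covers_def covering_relations_def)

lemma finite_covers: "finite covers"
proof (rule finite_subset)
  show "covers \<subseteq> {1..n} \<times> {1..n}" using covers_subset less_imp by fastforce
qed simp

lemma cover_eqI:
  assumes "(x, y) \<in> covers" "x \<preceq> a" "a \<prec> b" "b \<preceq> y"
  shows "(x, y) = (a, b)"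
proof -
  have no: "\<not> (x \<prec> k \<and> k \<prec> y)" for k
    using assms(1) by (auto simp: covers_def covering_relations_def)
  have "x = a" using assms no[of a] less_trans by blast
  moreover have "y = b" using assms no[of b] less_trans by blast
  ultimately show ?thesis by simp
qed

lemma covers_nonempty:
  assumes "S \<noteq> {}"
  shows "covers \<noteq> {}"
proof -
  obtain d where d: "d \<in> S" "\<And>d'. d' \<in> S \<Longrightarrow> snd d - fst d \<le> snd d' - fst d'"
    using assms ex_has_least_nat[of "\<lambda>d. d \<in> S" _ "\<lambda>d. snd d - fst d"] by blast
  obtain i j where ij: "d = (i, j)" by force
  have "\<not> (i \<prec> k \<and> k \<prec> j)" for k
  proof
    assume k: "i \<prec> k \<and> k \<prec> j"
    then show False using d(2)[of "(i, k)"] less_imp[of i k] less_imp[of k j] by (auto simp: ij)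
  qed
  then have "(i, j) \<in> covers" using d(1) by (auto simp: ij covers_def covering_relations_def)
  then show ?thesis by blast
qed

lemma trancl_covers_subset: "(covers - K)\<^sup>+ \<subseteq> S"
proof -
  have "trans S" using closed by (simp add: closed_pattern_def)
  moreover have "covers - K \<subseteq> S" using covers_subset by blast
  ultimately show ?thesis by (metis trancl_id trancl_mono_subset)
qed

lemma closed_trancl_covers: "closed_pattern n ((covers - K)\<^sup>+)"
  using closed trancl_covers_subset by (auto simp: closed_pattern_def)

text \<open>If all elements between \<open>i\<close> and \<open>j\<close> are below \<open>a\<close> or above \<open>b\<close>, then a chain from \<open>i\<close> to \<open>j\<close>
has to step from the lower part to the upper part, and the only covering relation that does so is
\<open>(a, b)\<close>. Conversely, a chain through any intermediate element uses \<open>(a, b)\<close> either before or after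
that element.\<close>

lemma through_iff:
  assumes c: "(a, b) \<in> covers"
  shows "(i, j) \<in> through (a, b) \<longleftrightarrow>
    i \<prec> j \<and> i \<preceq> a \<and> b \<preceq> j \<and> (\<forall>k. i \<prec> k \<and> k \<prec> j \<longrightarrow> k \<preceq> a \<or> b \<preceq> k)"
    (is "?L i j \<longleftrightarrow> ?R i j")
proof
  have ab: "a \<prec> b" using c covers_subset by blast
  show "?R i j" if "?L i j"
    using that
  proof (induction "j - i" arbitrary: i j rule: less_induct)
    case less
    have ij: "i \<prec> j" "(i, j) \<notin> (covers - {(a, b)})\<^sup>+" using less.prems by (auto simp: through_def)
    show ?case
    proof (cases "\<exists>k. i \<prec> k \<and> k \<prec> j")
      case False
      then have "(i, j) \<in> covers" using ij(1) by (auto simp: covers_def covering_relations_def)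
      then have "(i, j) = (a, b)" using ij(2) by blast
      then show ?thesis using ab False by auto
    next
      case True
      have split: "?R i k \<or> ?R k j" if k: "i \<prec> k" "k \<prec> j" for k
      proof -
        have "\<not> ((i, k) \<in> (covers - {(a, b)})\<^sup>+ \<and> (k, j) \<in> (covers - {(a, b)})\<^sup>+)"
          using ij(2) by (meson trancl_trans)
        then have "?L i k \<or> ?L k j" using k by (auto simp: through_def)
        moreover have "k - i < j - i" "j - k < j - i"
          using less_imp[OF k(1)] less_imp[OF k(2)] by auto
        ultimately show ?thesis using less.hyps by blast
      qed
      have "i \<preceq> a \<and> b \<preceq> j" using True split less_trans by blast
      moreover have "k \<preceq> a \<or> b \<preceq> k" if "i \<prec> k" "k \<prec> j" for k using split[OF that] by blast
      ultimately show ?thesis using ij(1) by blast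
    qed
  qed
  show "?L i j" if R: "?R i j"
  proof -
    have below: "y \<preceq> a" if "(x, y) \<in> covers - {(a, b)}" "x \<preceq> a" "i \<preceq> x" "y \<preceq> j" for x y
    proof -
      have "x \<prec> y" using that covers_subset by blast
      then have "i \<prec> y" using that less_trans by blast
      then have "y \<preceq> a \<or> b \<preceq> y" using R \<open>y \<preceq> j\<close> by blast
      moreover have "\<not> b \<preceq> y" using cover_eqI[of x y a b] that ab by blast
      ultimately show ?thesis by blast
    qed
    have "x \<preceq> j \<longrightarrow> x \<preceq> a" if "(i, x) \<in> (covers - {(a, b)})\<^sup>+" for x
      using that
    proof induction
      case (base y) then show ?case using below[of i y] R by blast
    next
      case (step y z)
      have "i \<prec> y" using step.hyps(1) trancl_covers_subset by blast
      moreover have "y \<prec> z" using step.hyps(2) covers_subset by blast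
      ultimately show ?case using below[of y z] step less_trans by blast
    qed
    moreover have "\<not> j \<preceq> a" using R ab less_imp less_trans by (metis less_irrefl)
    ultimately show ?thesis using R by (auto simp: through_def)
  qed
qed

lemma through_self: "c \<in> covers \<Longrightarrow> c \<in> through c"
proof -
  assume c: "c \<in> covers"
  obtain a b where ab: "c = (a, b)" by force
  have "\<not> (a \<prec> k \<and> k \<prec> b)" for k using c by (auto simp: ab covers_def covering_relations_def)
  then show "c \<in> through c" using c covers_subset unfolding ab by (subst through_iff) blast+
qed

lemma through_other: "c \<in> covers \<Longrightarrow> c \<noteq> d \<Longrightarrow> c \<notin> through d"
  by (cases c) (auto simp: through_def intro: r_into_trancl)

lemma throughD:
  assumes "(i, j) \<in> through (a, b)" "(a, b) \<in> covers"
  shows "i \<prec> j" "i \<preceq> a" "b \<preceq> j" "a \<prec> b" "i \<prec> b" "a \<prec> j"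
    "\<And>k. i \<preceq> k \<Longrightarrow> k \<preceq> j \<Longrightarrow> k \<preceq> a \<or> b \<preceq> k"
proof -
  show *: "i \<prec> j" "i \<preceq> a" "b \<preceq> j" "a \<prec> b"
    using assms through_iff covers_subset by blast+
  then show "i \<prec> b" "a \<prec> j" using less_trans by blast+
  show "k \<preceq> a \<or> b \<preceq> k" if "i \<preceq> k" "k \<preceq> j" for k
    using assms * that through_iff by blast
qed

lemma not_both: "i \<prec> j \<Longrightarrow> \<not> j \<preceq> i"
  using less_imp[of i j] less_imp[of j i] by auto

lemma through_shrink:
  assumes "(i, j) \<in> through (a, b)" "(a, b) \<in> covers"
    "i \<preceq> i'" "i' \<preceq> a" "b \<preceq> j'" "j' \<preceq> j"
  shows "(i', j') \<in> through (a, b)"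
proof -
  note T = throughD[OF assms(1,2)]
  have "i' \<prec> j'" using assms T(4) less_trans by blast
  moreover have "k \<preceq> a \<or> b \<preceq> k" if "i' \<prec> k" "k \<prec> j'" for k
  proof (rule T(7))
    show "i \<preceq> k" using that assms(3) less_trans by blast
    show "k \<preceq> j" using that assms(6) less_trans by blast
  qed
  ultimately show ?thesis using assms through_iff by blast
qed

lemma through_split:
  assumes "(i, j) \<in> through c" "i \<prec> k" "k \<prec> j"
  shows "(i, k) \<in> through c \<or> (k, j) \<in> through c"
  using assms by (auto simp: through_def intro: trancl_trans)

text \<open>If all elements between \<open>i\<close> and \<open>j\<close> are comparable to \<open>k\<close>, then every saturated chain from \<open>i\<close> to
\<open>j\<close> passes \<open>k\<close>. So what is unavoidable on the way from \<open>i\<close> to \<open>k\<close> remains unavoidable on the way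
to \<open>j\<close>. This is used with \<open>k\<close> an end of an unavoidable covering relation.\<close>

lemma through_extend_right:
  assumes "(i, k) \<in> through d" "d \<in> covers" "k \<preceq> j"
    and comp: "\<And>l. i \<prec> l \<Longrightarrow> l \<prec> j \<Longrightarrow> l \<preceq> k \<or> k \<preceq> l"
  shows "(i, j) \<in> through d"
proof -
  obtain a b where d: "d = (a, b)" by force
  note T = throughD[OF assms(1,2)[unfolded d]]
  have "l \<preceq> a \<or> b \<preceq> l" if "i \<prec> l" "l \<prec> j" for l
    using comp[OF that] that T(3) T(7)[of l] less_trans by blast
  moreover have "i \<prec> j" "b \<preceq> j" using T(1,3) assms(3) less_trans by blast+
  ultimately show ?thesis using T(2) assms(2) through_iff unfolding d by blast
qed

lemma through_extend_left:
  assumes "(k, j) \<in> through d" "d \<in> covers" "i \<preceq> k"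
    and comp: "\<And>l. i \<prec> l \<Longrightarrow> l \<prec> j \<Longrightarrow> l \<preceq> k \<or> k \<preceq> l"
  shows "(i, j) \<in> through d"
proof -
  obtain a b where d: "d = (a, b)" by force
  note T = throughD[OF assms(1,2)[unfolded d]]
  have "l \<preceq> a \<or> b \<preceq> l" if "i \<prec> l" "l \<prec> j" for l
    using comp[OF that] that T(2) T(7)[of l] less_trans by blast
  moreover have "i \<prec> j" "i \<preceq> a" using T(1,2) assms(3) less_trans by blast+
  ultimately show ?thesis using T(3) assms(2) through_iff unfolding d by blast
qed

lemma through_comparable:
  assumes "(i, j) \<in> through (a, b)" "(a, b) \<in> covers" "i \<prec> l" "l \<prec> j" "k = a \<or> k = b"
  shows "l \<preceq> k \<or> k \<preceq> l"
  using throughD[OF assms(1,2)] assms(3-5) less_trans by blast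

text \<open>Two unavoidable covering relations lie on a common chain, hence one of them comes first.\<close>

lemma through_linear:
  assumes "(i, j) \<in> through (a, b)" "(i, j) \<in> through (a', b')"
    "(a, b) \<in> covers" "(a', b') \<in> covers" "(a, b) \<noteq> (a', b')"
  shows "b \<preceq> a' \<or> b' \<preceq> a"
proof (rule ccontr)
  note T = throughD[OF assms(1,3)] and T' = throughD[OF assms(2,4)]
  assume no: "\<not> ?thesis"
  then have "b' \<preceq> b" using T'(7)[of b] T by blast
  moreover have "a' \<preceq> a" using T(7)[of a'] T' no by blast
  moreover have "b \<preceq> b'" using T(7)[of b'] T' no by blast
  ultimately have "b = b'" using not_both by blast
  then have "(a', b') = (a, b)" using cover_eqI[of a' b' a b] assms \<open>a' \<preceq> a\<close> T(4) by blast
  then show False using assms(5) by simp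
qed

lemma closed_avoiding: "closed_pattern n (avoiding J)"
proof -
  have "trans (avoiding J)"
  proof (rule transI)
    fix i j k assume *: "(i, j) \<in> avoiding J" "(j, k) \<in> avoiding J"
    then have "i \<prec> j" "j \<prec> k" by (auto simp: avoiding_def)
    moreover from this have "i \<prec> k" by (rule less_trans)
    ultimately show "(i, k) \<in> avoiding J" using * through_split unfolding avoiding_def by blast
  qed
  then show ?thesis using in_Delta by (auto simp: closed_pattern_def avoiding_def)
qed

lemma avoiding_subset: "avoiding J \<subseteq> S"
  by (auto simp: avoiding_def)

text \<open>The combinatorial form both of the normality of \<open>B\<close> and of the residues of all flags of corank one
having exactly \<open>q\<close> elements.\<close>

definition rigid :: bool where
  "rigid \<longleftrightarrow> (\<forall>c\<in>covers. through c \<inter> avoiding (covers - {c}) \<subseteq> {c})"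

text \<open>If the composite \<open>(i, k)\<close> is forced through covering relations, let \<open>(a, b)\<close> be the first of them.
The pair \<open>(i, b)\<close> is forced through \<open>(a, b)\<close> only, since every other relation on which it depended would come
earlier. By rigidity \<open>i = a\<close>. But \<open>(i, j)\<close> is not forced through \<open>(a, b)\<close>, so \<open>i \<prec> j \<preceq> a\<close>.\<close>

lemma rigid_imp_ideal_right:
  assumes rigid and ij: "(i, j) \<in> avoiding covers" and jk: "j \<prec> k"
  shows "(i, k) \<in> avoiding covers"
proof (rule ccontr)
  assume no: "(i, k) \<notin> avoiding covers"
  have ij': "i \<prec> j" using ij by (simp add: avoiding_def)
  then have "i \<prec> k" using jk less_trans by blast
  then obtain c0 where c0: "c0 \<in> covers \<and> (i, k) \<in> through c0" using no by (auto simp: avoiding_def)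
  obtain c where c: "c \<in> covers" "(i, k) \<in> through c"
    and min: "\<And>d. d \<in> covers \<Longrightarrow> (i, k) \<in> through d \<Longrightarrow> fst c \<le> fst d"
    using ex_has_least_nat[of "\<lambda>c. c \<in> covers \<and> (i, k) \<in> through c" c0 fst] c0 by blast
  obtain a b where ab: "c = (a, b)" by force
  note T = throughD[OF c(2,1)[unfolded ab]]
  have "(i, j) \<notin> through c" using ij c(1) by (auto simp: avoiding_def)
  then have "(j, k) \<in> through c" using through_split[OF c(2) ij' jk] by blast
  then have ja: "j \<preceq> a" using throughD(2)[OF _ c(1)[unfolded ab]] unfolding ab by blast
  have ib: "(i, b) \<in> through c" using through_shrink[OF c(2,1)[unfolded ab], of i b] T unfolding ab by blast
  moreover have "(i, b) \<notin> through d" if d: "d \<in> covers" "d \<noteq> c" for d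
  proof
    assume id: "(i, b) \<in> through d"
    obtain a' b' where d': "d = (a', b')" by force
    have "(i, k) \<in> through d"
      using through_extend_right[OF id d(1) T(3)] through_comparable[OF c(2,1)[unfolded ab]] by blast
    then have "a \<le> a'" using min[OF d(1)] unfolding ab d' by simp
    moreover have "b \<preceq> a' \<or> b' \<preceq> a"
      using through_linear[of i b a b a' b'] ib id c(1) d unfolding ab d' by blast
    then have "b \<le> a' \<or> b' \<le> a" using less_eq_imp by blast
    moreover have "b' \<preceq> b" "a' \<prec> b'" using throughD[OF id[unfolded d'] d(1)[unfolded d']] by blast+
    then have "b' \<le> b" "a' < b'" using less_eq_imp less_imp by blast+
    ultimately show False by linarith
  qed
  ultimately have "(i, b) \<in> through c \<inter> avoiding (covers - {c})" using T(5) by (auto simp: avoiding_def)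
  then have "i = a" using assms(1) c(1) unfolding rigid_def ab by blast
  then show False using ja ij' not_both by blast
qed

text \<open>The dual argument, with the last covering relation through which \<open>(i, k)\<close> is forced.\<close>

lemma rigid_imp_ideal_left:
  assumes rigid and ij: "i \<prec> j" and jk: "(j, k) \<in> avoiding covers"
  shows "(i, k) \<in> avoiding covers"
proof (rule ccontr)
  assume no: "(i, k) \<notin> avoiding covers"
  have jk': "j \<prec> k" using jk by (simp add: avoiding_def)
  then have "i \<prec> k" using ij less_trans by blast
  then obtain c0 where c0: "c0 \<in> covers \<and> (i, k) \<in> through c0" using no by (auto simp: avoiding_def)
  obtain c where c: "c \<in> covers" "(i, k) \<in> through c"
    and max: "\<And>d. d \<in> covers \<Longrightarrow> (i, k) \<in> through d \<Longrightarrow> n - fst c \<le> n - fst d"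
    using ex_has_least_nat[of "\<lambda>c. c \<in> covers \<and> (i, k) \<in> through c" c0 "\<lambda>c. n - fst c"] c0 by blast
  obtain a b where ab: "c = (a, b)" by force
  note T = throughD[OF c(2,1)[unfolded ab]]
  have "(j, k) \<notin> through c" using jk c(1) by (auto simp: avoiding_def)
  then have "(i, j) \<in> through c" using through_split[OF c(2) ij jk'] by blast
  then have bj: "b \<preceq> j" using throughD(3)[OF _ c(1)[unfolded ab]] unfolding ab by blast
  have ak: "(a, k) \<in> through c" using through_shrink[OF c(2,1)[unfolded ab], of a k] T unfolding ab by blast
  moreover have "(a, k) \<notin> through d" if d: "d \<in> covers" "d \<noteq> c" for d
  proof
    assume id: "(a, k) \<in> through d"
    obtain a' b' where d': "d = (a', b')" by force
    have "(i, k) \<in> through d"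
      using through_extend_left[OF id d(1) T(2)] through_comparable[OF c(2,1)[unfolded ab]] by blast
    then have "n - a \<le> n - a'" using max[OF d(1)] unfolding ab d' by simp
    moreover have "a' \<prec> b'" "a \<preceq> a'" using throughD[OF id[unfolded d'] d(1)[unfolded d']] by blast+
    then have "a' < b'" "b' \<le> n" "a \<le> a'" using less_eq_imp less_imp by blast+
    moreover have "a < b" using T(4) less_imp by blast
    moreover have "b \<preceq> a' \<or> b' \<preceq> a"
      using through_linear[of a k a b a' b'] ak id c(1) d unfolding ab d' by blast
    then have "b \<le> a' \<or> b' \<le> a" using less_eq_imp by blast
    ultimately show False by linarith
  qed
  ultimately have "(a, k) \<in> through c \<inter> avoiding (covers - {c})" using T(6) by (auto simp: avoiding_def)
  then have "k = b" using assms(1) c(1) unfolding rigid_def ab by blast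
  then show False using bj jk' not_both by blast
qed

text \<open>A pair \<open>(i, k) \<noteq> (a, b)\<close> that is forced through \<open>(a, b)\<close> only has \<open>i \<prec> a\<close> or \<open>b \<prec> k\<close>. In either case
a pair that can avoid each covering relation becomes, when composed with \<open>(a, b)\<close>, one that cannot.\<close>

lemma not_rigid_cases:
  assumes "\<not> rigid"
  obtains a b i where "(a, b) \<in> covers" "(i, a) \<in> avoiding covers" "(i, b) \<in> through (a, b)"
  | a b k where "(a, b) \<in> covers" "(b, k) \<in> avoiding covers" "(a, k) \<in> through (a, b)"
proof -
  obtain a b i k where c: "(a, b) \<in> covers" and ik: "(i, k) \<in> through (a, b)"
    and only: "(i, k) \<in> avoiding (covers - {(a, b)})" and ne: "(i, k) \<noteq> (a, b)"
    using assms unfolding rigid_def by fast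
  note T = throughD[OF ik c]
  have onlyD: "d = (a, b)" if "(i, k) \<in> through d" "d \<in> covers" for d
    using only that by (auto simp: avoiding_def)
  consider "i \<prec> a" | "b \<prec> k" using T ne by blast
  then show thesis
  proof cases
    case 1
    have "(i, a) \<notin> through d" if d: "d \<in> covers" for d
    proof
      assume ia: "(i, a) \<in> through d"
      have "(i, k) \<in> through d"
        by (rule through_extend_right[OF ia d]) (use T(6) through_comparable[OF ik c] in blast)+
      then have "d = (a, b)" using onlyD d by blast
      then show False using throughD(3)[of i a a b] ia c not_both[OF T(4)] by blast
    qed
    then have "(i, a) \<in> avoiding covers" using 1 by (auto simp: avoiding_def)
    moreover have "(i, b) \<in> through (a, b)" using through_shrink[OF ik c, of i b] T by blast
    ultimately show thesis using that(1) c by blast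
  next
    case 2
    have "(b, k) \<notin> through d" if d: "d \<in> covers" for d
    proof
      assume bk: "(b, k) \<in> through d"
      have "(i, k) \<in> through d"
        by (rule through_extend_left[OF bk d]) (use T(5) through_comparable[OF ik c] in blast)+
      then have "d = (a, b)" using onlyD d by blast
      then show False using throughD(2)[of b k a b] bk c not_both[OF T(4)] by blast
    qed
    then have "(b, k) \<in> avoiding covers" using 2 by (auto simp: avoiding_def)
    moreover have "(a, k) \<in> through (a, b)" using through_shrink[OF ik c, of a k] T by blast
    ultimately show thesis using that(2) c by blast
  qed
qed

text \<open>If \<open>c\<close> precedes \<open>d\<close>, cut at the upper end of \<open>c\<close>: the lower part is then not forced through \<open>d\<close>, the
upper part not through \<open>c\<close>, and neither part is forced through anything that \<open>(i, j)\<close> can avoid.\<close>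

lemma avoiding_split:
  assumes J: "J \<subseteq> covers" and c: "c \<in> covers - J" "d \<in> covers - J" "c \<noteq> d"
    and ij: "(i, j) \<in> avoiding J" "(i, j) \<in> through c" "(i, j) \<in> through d"
  obtains k where "(i, k) \<in> avoiding (insert c J) \<union> avoiding (insert d J)"
    "(k, j) \<in> avoiding (insert c J) \<union> avoiding (insert d J)"
proof -
  have key: "\<exists>k. (i, k) \<in> avoiding (insert (a', b') J) \<and> (k, j) \<in> avoiding (insert (a, b) J)"
    if "(a, b) \<in> covers" "(a', b') \<in> covers" "(i, j) \<in> through (a, b)"
      "(i, j) \<in> through (a', b')" "b \<preceq> a'" for a b a' b'
  proof -
    note T = throughD[OF that(3,1)] and T' = throughD[OF that(4,2)]
    note comp = through_comparable[OF that(3,1)]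
    have bj: "b \<prec> j" using \<open>b \<preceq> a'\<close> T'(6) less_trans by blast
    have "(i, b) \<notin> through e" "(b, j) \<notin> through e" if "e \<in> J" for e
    proof -
      have e: "e \<in> covers" "(i, j) \<notin> through e" using that J ij(1) by (auto simp: avoiding_def)
      show "(i, b) \<notin> through e" using through_extend_right[of i b e j] e T(3) comp by blast
      show "(b, j) \<notin> through e" using through_extend_left[of b j e i] e T(5) comp by blast
    qed
    moreover have "(i, b) \<notin> through (a', b')"
    proof
      assume "(i, b) \<in> through (a', b')"
      then have "b' \<preceq> b" using throughD(3) \<open>(a', b') \<in> covers\<close> by blast
      then show False using \<open>b \<preceq> a'\<close> T'(4) not_both less_trans by blast
    qed
    moreover have "(b, j) \<notin> through (a, b)"
    proof
      assume "(b, j) \<in> through (a, b)"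
      then have "b \<preceq> a" using throughD(2) \<open>(a, b) \<in> covers\<close> by blast
      then show False using T(4) not_both by blast
    qed
    ultimately show ?thesis using T(5) bj by (auto simp: avoiding_def)
  qed
  obtain a b a' b' where ab: "c = (a, b)" "d = (a', b')" by (metis surj_pair)
  have "b \<preceq> a' \<or> b' \<preceq> a" using through_linear c ij unfolding ab by blast
  then show thesis using key[of a b a' b'] key[of a' b' a b] c ij that unfolding ab by blast
qed

end

section \<open>The coset geometry of a pattern group\<close>

lemma pattern_group_subpattern_iff:
  assumes "S' \<subseteq> S"
  shows "g \<in> carrier (pattern_group n S') \<longleftrightarrow>
    g \<in> carrier (pattern_group n S) \<and> (\<forall>(i, j)\<in>(S - S') \<inter> Delta n. entry g i j = 0)"
proof
  assume g: "g \<in> carrier (pattern_group n S')"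
  have "entry g i j = 0" if "(i, j) \<in> (S - S') \<inter> Delta n" for i j
    using that by (intro pattern_groupD(3)[OF g]) (auto simp: Delta_def)
  then show "g \<in> carrier (pattern_group n S) \<and> (\<forall>(i, j)\<in>(S - S') \<inter> Delta n. entry g i j = 0)"
    using g pattern_group_mono[OF assms] by blast
next
  assume g: "g \<in> carrier (pattern_group n S) \<and> (\<forall>(i, j)\<in>(S - S') \<inter> Delta n. entry g i j = 0)"
  then have g': "g \<in> carrier (pattern_group n S)" by blast
  show "g \<in> carrier (pattern_group n S')"
  proof (rule pattern_groupI)
    fix i j assume ij: "i \<in> {1..n}" "j \<in> {1..n}" "i \<noteq> j" "(i, j) \<notin> S' \<inter> Delta n"
    show "entry g i j = 0"
    proof (cases "(i, j) \<in> S \<inter> Delta n")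
      case True then show ?thesis using g ij by blast
    qed (rule pattern_groupD(3)[OF g' ij(1-3)])
  qed (use pattern_groupD[OF g'] in auto)
qed

lemma finite_carrier_mat: "finite (carrier_mat n m :: 'a::finite mat set)"
proof (rule finite_subset)
  show "carrier_mat n m \<subseteq> (\<lambda>f. mat n m f) ` (({..<n} \<times> {..<m}) \<rightarrow>\<^sub>E (UNIV :: 'a set))"
  proof
    fix A :: "'a mat" assume A: "A \<in> carrier_mat n m"
    have "A = mat n m (restrict (($$) A) ({..<n} \<times> {..<m}))" using A by (intro eq_matI) auto
    moreover have "restrict (($$) A) ({..<n} \<times> {..<m}) \<in> ({..<n} \<times> {..<m}) \<rightarrow>\<^sub>E UNIV" by simp
    ultimately show "A \<in> (\<lambda>f. mat n m f) ` (({..<n} \<times> {..<m}) \<rightarrow>\<^sub>E UNIV)" by (rule image_eqI)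
  qed
  show "finite ((\<lambda>f. mat n m f) ` (({..<n} \<times> {..<m}) \<rightarrow>\<^sub>E (UNIV :: 'a set)))"
    by (intro finite_imageI finite_PiE) auto
qed

locale pattern_geometry = pattern n S for n S +
  fixes U :: "'a::{field,finite} mat monoid"
  assumes U_eq: "U = pattern_group n S"
begin

definition H :: "nat \<times> nat \<Rightarrow> 'a mat set" where
  "H c = carrier (pattern_group n ((covers - {c})\<^sup>+))"

sublocale subgroup_family U covers H
proof (intro subgroup_family.intro subgroup_family_axioms.intro)
  show "group U" unfolding U_eq by (rule group_pattern_group[OF closed])
  show "finite covers" by (rule finite_covers)
  fix c
  show "subgroup (H c) U"
    unfolding H_def U_eq by (intro subgroup_pattern_group closed closed_trancl_covers trancl_covers_subset)
qed

lemma U_mult [simp]: "g \<otimes>\<^bsub>U\<^esub> h = g * h" "\<one>\<^bsub>U\<^esub> = 1\<^sub>m n"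
  by (simp_all add: U_eq)

lemma U_D:
  assumes "g \<in> carrier U"
  shows "g \<in> carrier_mat n n" "\<And>i. i \<in> {1..n} \<Longrightarrow> entry g i i = 1"
    "\<And>i j. i \<in> {1..n} \<Longrightarrow> j \<in> {1..n} \<Longrightarrow> i \<noteq> j \<Longrightarrow> \<not> i \<prec> j \<Longrightarrow> entry g i j = 0"
  using pattern_groupD[OF assms[unfolded U_eq]] by auto

lemma H_iff: "g \<in> H c \<longleftrightarrow> g \<in> carrier U \<and> (\<forall>(i, j)\<in>through c. entry g i j = 0)"
proof -
  have "(S - (covers - {c})\<^sup>+) \<inter> Delta n = through c" using in_Delta by (auto simp: through_def)
  then show ?thesis
    unfolding H_def U_eq by (subst pattern_group_subpattern_iff[OF trancl_covers_subset]) simp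
qed

lemma stabilizer_of_eq: "stabilizer_of J = carrier (pattern_group n (avoiding J))"
proof -
  have "(S - avoiding J) \<inter> Delta n = (\<Union>c\<in>J. through c)"
    using in_Delta by (auto simp: avoiding_def through_def)
  then have "g \<in> carrier (pattern_group n (avoiding J)) \<longleftrightarrow>
      g \<in> carrier U \<and> (\<forall>(i, j)\<in>(\<Union>c\<in>J. through c). entry g i j = 0)" for g :: "'a mat"
    unfolding U_eq by (subst pattern_group_subpattern_iff[OF avoiding_subset]) simp
  then show ?thesis by (auto simp: stabilizer_of_def H_iff)
qed

lemma root_mem_U: "d \<in> S \<Longrightarrow> elem_unitriangular n d t \<in> carrier U"
  unfolding U_eq by (intro elem_unitriangular_mem in_Delta)

lemma root_mem_stabilizer: "d \<in> avoiding J \<Longrightarrow> elem_unitriangular n d t \<in> stabilizer_of J"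
  unfolding stabilizer_of_eq using avoiding_subset by (intro elem_unitriangular_mem in_Delta) auto

lemma inv_root: "d \<in> S \<Longrightarrow> inv\<^bsub>U\<^esub> (elem_unitriangular n d t) = elem_unitriangular n d (- t)"
  unfolding U_eq by (rule inv_elem_unitriangular[OF closed])

lemma index_bounds: "i \<prec> j \<Longrightarrow> i \<in> {1..n} \<and> j \<in> {1..n} \<and> i \<noteq> j"
  using less_imp[of i j] by auto

section \<open>Flag-transitivity\<close>

text \<open>In the expansion of the entry at \<open>(i, j)\<close>, each intermediate index \<open>k\<close> gives a pair \<open>(i, k)\<close> or
\<open>(k, j)\<close> in \<open>through c\<close>, by \<open>through_split\<close>; in the first case \<open>x\<close> vanishes there, in the second
\<open>u\<close> does.\<close>

lemma entry_mult_H: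
  assumes x: "x \<in> carrier U" and u: "u \<in> H c" and c: "c \<in> covers"
    and ij: "(i, j) \<in> through c"
    and zero: "\<And>k. (i, k) \<in> through c \<Longrightarrow> k < j \<Longrightarrow> entry x i k = 0"
  shows "entry (x * u) i j = entry x i j"
proof -
  have uU: "u \<in> carrier U" using u by (simp add: H_iff)
  have uz: "entry u k j = 0" if "(k, j) \<in> through c" for k using u that unfolding H_iff by blast
  have b: "i \<in> {1..n}" "j \<in> {1..n}" using index_bounds ij by (auto simp: through_def)
  have z: "entry x i k * entry u k j = 0" if k: "k \<in> {1..n}" "k \<noteq> j" for k
  proof (cases "k = i")
    case True then show ?thesis using uz ij by simp
  next
    case False
    consider "\<not> i \<prec> k" | "\<not> k \<prec> j" | "i \<prec> k" "k \<prec> j" by blast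
    then show ?thesis
    proof cases
      case 1 then show ?thesis using U_D(3)[OF x b(1) k(1)] False by simp
    next
      case 2 then show ?thesis using U_D(3)[OF uU k(1) b(2)] k by simp
    next
      case 3 then show ?thesis using through_split[OF ij 3] zero uz less_imp[OF 3(2)] by auto
    qed
  qed
  have "entry (x * u) i j = (\<Sum>k\<in>{1..n}. entry x i k * entry u k j)"
    by (rule entry_mult[OF U_D(1)[OF x] U_D(1)[OF uU] b])
  also have "\<dots> = (\<Sum>k\<in>{j}. entry x i k * entry u k j)"
    using b z by (intro sum.mono_neutral_right) auto
  also have "\<dots> = entry x i j" using U_D(2)[OF uU b(2)] by simp
  finally show ?thesis .
qed

text \<open>One superdiagonal of the construction of a common element. The correction \<open>g\<close> is the identity
outside of the superdiagonal \<open>m\<close>, where it takes the entries of those \<open>h c\<close> with \<open>(i, j)\<close> in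
\<open>through c\<close>; by \<open>entry_mult_H\<close> these entries do not depend on \<open>c\<close>.\<close>

lemma helly_step:
  assumes J: "J \<subseteq> covers" and h: "\<And>c. c \<in> J \<Longrightarrow> h c \<in> carrier U"
    and meet: "\<And>c d. c \<in> J \<Longrightarrow> d \<in> J \<Longrightarrow> (h c <#\<^bsub>U\<^esub> H c) \<inter> (h d <#\<^bsub>U\<^esub> H d) \<noteq> {}"
    and zero: "\<And>c i j. c \<in> J \<Longrightarrow> (i, j) \<in> through c \<Longrightarrow> j - i < m \<Longrightarrow> entry (h c) i j = 0"
  shows "\<exists>g\<in>carrier U. \<forall>c\<in>J. \<forall>(i, j)\<in>through c. j - i < Suc m \<longrightarrow> entry (inv\<^bsub>U\<^esub> g * h c) i j = 0"
proof -
  have agree: "entry (h c) i j = entry (h d) i j"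
    if cd: "c \<in> J" "d \<in> J" and ij: "(i, j) \<in> through c" "(i, j) \<in> through d" "j - i = m" for c d i j
  proof -
    obtain u v where uv: "u \<in> H c" "v \<in> H d" "h c * u = h d * v"
      using meet[OF cd] by (auto simp: l_coset_def)
    have z: "entry (h e) i k = 0" if e: "e \<in> J" "(i, k) \<in> through e" and "k < j" for e k
    proof (rule zero[OF e])
      have "i < k" using e less_imp by (auto simp: through_def)
      then show "k - i < m" using \<open>k < j\<close> ij(3) by linarith
    qed
    have "entry (h c * u) i j = entry (h c) i j"
      by (rule entry_mult_H[OF h[OF cd(1)] uv(1) _ ij(1) z[OF cd(1)]]) (use J cd in auto)
    moreover have "entry (h d * v) i j = entry (h d) i j"
      by (rule entry_mult_H[OF h[OF cd(2)] uv(2) _ ij(2) z[OF cd(2)]]) (use J cd in auto)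
    ultimately show ?thesis using uv(3) by simp
  qed
  define new where "new i j \<longleftrightarrow> j - i = m \<and> (\<exists>c\<in>J. (i, j) \<in> through c)" for i j
  define e where "e i j = entry (h (SOME c. c \<in> J \<and> (i, j) \<in> through c)) i j" for i j
  have e: "e i j = entry (h c) i j" if "c \<in> J" "(i, j) \<in> through c" "j - i = m" for c i j
  proof -
    define d where "d = (SOME c. c \<in> J \<and> (i, j) \<in> through c)"
    have "d \<in> J \<and> (i, j) \<in> through d" unfolding d_def by (rule someI[of _ c]) (use that in blast)
    then show ?thesis using agree[of d c i j] that by (simp add: e_def d_def[symmetric])
  qed
  define g :: "'a mat" where "g = mat n n (\<lambda>(i, j). if i = j then 1 else if new (Suc i) (Suc j) then e (Suc i) (Suc j) else 0)"
  have ge: "entry g i j = (if i = j then 1 else if new i j then e i j else 0)"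
    if "i \<in> {1..n}" "j \<in> {1..n}" for i j
    using that by (auto simp: entry_def g_def)
  have newS: "i \<prec> j" if "new i j" for i j using that by (auto simp: new_def through_def)
  have g: "g \<in> carrier U"
    unfolding U_eq
  proof (rule pattern_groupI)
    show "g \<in> carrier_mat n n" by (simp add: g_def)
  qed (use ge newS in_Delta in auto)
  have "entry (inv\<^bsub>U\<^esub> g * h c) i j = 0"
    if c: "c \<in> J" and ij: "(i, j) \<in> through c" and len: "j - i < Suc m" for c i j
  proof -
    define w where "w = inv\<^bsub>U\<^esub> g * h c"
    have w: "w \<in> carrier U" using g h[OF c] m_closed[of "inv\<^bsub>U\<^esub> g" "h c"] by (simp add: w_def)
    have gw: "h c = g * w"
      using g h[OF c] m_assoc[of g "inv\<^bsub>U\<^esub> g" "h c"] r_inv[OF g] l_one[OF h[OF c]]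
      by (simp add: w_def)
    have S: "i \<prec> j" using ij by (simp add: through_def)
    then have b: "i \<in> {1..n}" "j \<in> {1..n}" "i \<noteq> j" using index_bounds by blast+
    have "entry (h c) i j = (\<Sum>k\<in>{1..n}. entry g i k * entry w k j)"
      unfolding gw by (rule entry_mult[OF U_D(1)[OF g] U_D(1)[OF w] b(1,2)])
    also have "\<dots> = (\<Sum>k\<in>{i, j}. entry g i k * entry w k j)"
    proof (rule sum.mono_neutral_right)
      show "\<forall>k\<in>{1..n} - {i, j}. entry g i k * entry w k j = 0"
      proof
        fix k assume k: "k \<in> {1..n} - {i, j}"
        have "\<not> (new i k \<and> k \<prec> j)"
        proof
          assume "new i k \<and> k \<prec> j"
          then have "k - i = m" "i < k" "k < j" using newS less_imp by (auto simp: new_def)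
          then show False using len by linarith
        qed
        then show "entry g i k * entry w k j = 0"
          using ge[OF b(1), of k] U_D(3)[OF w _ b(2), of k] k by auto
      qed
    qed (use b in auto)
    also have "\<dots> = entry w i j + (if new i j then e i j else 0)"
      using b ge[OF b(1,1)] ge[OF b(1,2)] U_D(2)[OF w b(2)] by simp
    finally have "entry (h c) i j = entry w i j + (if new i j then e i j else 0)" .
    moreover have "(if new i j then e i j else 0) = entry (h c) i j"
    proof (cases "j - i = m")
      case True
      then have "new i j" using c ij by (auto simp: new_def)
      then show ?thesis using e[OF c ij True] by simp
    next
      case False
      then show ?thesis using zero[OF c ij] len by (simp add: new_def)
    qed
    ultimately show ?thesis by (simp add: w_def)
  qed
  then show ?thesis using g by blast
qed

sublocale helly_family U covers H
proof unfold_locales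
  fix J f
  assume J: "J \<subseteq> covers" and f: "\<And>c. c \<in> J \<Longrightarrow> f c \<in> carrier U"
    and meet: "\<And>c d. c \<in> J \<Longrightarrow> d \<in> J \<Longrightarrow> (f c <#\<^bsub>U\<^esub> H c) \<inter> (f d <#\<^bsub>U\<^esub> H d) \<noteq> {}"
  have "\<exists>g\<in>carrier U. \<forall>c\<in>J. \<forall>(i, j)\<in>through c. j - i < m \<longrightarrow> entry (inv\<^bsub>U\<^esub> g * f c) i j = 0" for m
  proof (induction m)
    case 0 then show ?case using one_closed by blast
  next
    case (Suc m)
    then obtain g where g: "g \<in> carrier U"
      and z: "\<And>c i j. c \<in> J \<Longrightarrow> (i, j) \<in> through c \<Longrightarrow> j - i < m \<Longrightarrow> entry (inv\<^bsub>U\<^esub> g * f c) i j = 0"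
      by blast
    have cl: "inv\<^bsub>U\<^esub> g * f c \<in> carrier U" if "c \<in> J" for c
      using m_closed[of "inv\<^bsub>U\<^esub> g" "f c"] g f[OF that] by simp
    have meet': "(inv\<^bsub>U\<^esub> g * f c <#\<^bsub>U\<^esub> H c) \<inter> (inv\<^bsub>U\<^esub> g * f d <#\<^bsub>U\<^esub> H d) \<noteq> {}"
      if cd: "c \<in> J" "d \<in> J" for c d
    proof -
      have tr: "inv\<^bsub>U\<^esub> g * f e <#\<^bsub>U\<^esub> H e = inv\<^bsub>U\<^esub> g <#\<^bsub>U\<^esub> (f e <#\<^bsub>U\<^esub> H e)" if "e \<in> J" for e
        using lcos_m_assoc[of "H e" "inv\<^bsub>U\<^esub> g" "f e"] subgroup.subset[OF subgroups, of e] J f g that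
        by auto
      obtain x where "x \<in> f c <#\<^bsub>U\<^esub> H c" "x \<in> f d <#\<^bsub>U\<^esub> H d" using meet[OF cd] by blast
      then have "inv\<^bsub>U\<^esub> g * x \<in> (inv\<^bsub>U\<^esub> g * f c <#\<^bsub>U\<^esub> H c) \<inter> (inv\<^bsub>U\<^esub> g * f d <#\<^bsub>U\<^esub> H d)"
        unfolding tr[OF cd(1)] tr[OF cd(2)]
        unfolding l_coset_def[of U "inv\<^bsub>U\<^esub> g"] by simp blast
      then show ?thesis by blast
    qed
    have "\<exists>g'\<in>carrier U. \<forall>c\<in>J. \<forall>(i, j)\<in>through c. j - i < Suc m \<longrightarrow>
        entry (inv\<^bsub>U\<^esub> g' * (inv\<^bsub>U\<^esub> g * f c)) i j = 0"
      by (rule helly_step[where h = "\<lambda>c. inv\<^bsub>U\<^esub> g * f c", OF J]) (fact cl meet' z)+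
    then obtain g' where g': "g' \<in> carrier U"
      and z': "\<And>c i j. c \<in> J \<Longrightarrow> (i, j) \<in> through c \<Longrightarrow> j - i < Suc m \<Longrightarrow>
        entry (inv\<^bsub>U\<^esub> g' * (inv\<^bsub>U\<^esub> g * f c)) i j = 0" by blast
    have "inv\<^bsub>U\<^esub> (g * g') * f c = inv\<^bsub>U\<^esub> g' * (inv\<^bsub>U\<^esub> g * f c)" if "c \<in> J" for c
      using inv_mult_group[OF g g'] m_assoc[of "inv\<^bsub>U\<^esub> g'" "inv\<^bsub>U\<^esub> g" "f c"] g g' f[OF that] by simp
    moreover have "g * g' \<in> carrier U" using m_closed[OF g g'] by simp
    ultimately show ?case using z' by (intro bexI[of _ "g * g'"]) auto
  qed
  \<comment> \<open>All pairs satisfy \<open>j - i < n\<close>, so at this stage the entries vanish on the whole of \<open>through c\<close>.\<close>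
  from this[of n] obtain g where g: "g \<in> carrier U"
    and z: "\<And>c i j. c \<in> J \<Longrightarrow> (i, j) \<in> through c \<Longrightarrow> j - i < n \<Longrightarrow> entry (inv\<^bsub>U\<^esub> g * f c) i j = 0"
    by blast
  have "g \<in> f c <#\<^bsub>U\<^esub> H c" if c: "c \<in> J" for c
  proof -
    have cI: "c \<in> covers" using c J by blast
    have "j - i < n" if "(i, j) \<in> through c" for i j
      using less_imp[of i j] that by (auto simp: through_def)
    then have "inv\<^bsub>U\<^esub> g \<otimes>\<^bsub>U\<^esub> f c \<in> H c"
      using z[OF c] m_closed[OF inv_closed[OF g] f[OF c]] by (auto simp: H_iff)
    then have "f c \<in> g <#\<^bsub>U\<^esub> H c" using mem_coset_iff[OF cI g f[OF c]] by blast
    then show ?thesis using coset_eq[OF _ g cI] mem_coset[OF cI g] by blast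
  qed
  then show "\<exists>g\<in>carrier U. \<forall>c\<in>J. g \<in> f c <#\<^bsub>U\<^esub> H c" using g by blast
qed

section \<open>Residual connectedness\<close>

lemma residually_connected_cosets: "residually_connected cosets"
proof (rule residually_connectedI)
  fix J assume J: "J \<subseteq> covers" and card: "2 \<le> card (covers - J)"
  define K where "K = (\<Union>c\<in>covers - J. stabilizer_of (insert c J))"
  have KU: "K \<subseteq> carrier U" by (auto simp: K_def stabilizer_of_def)
  interpret K: subgroup "generate U K" U by (rule generate_is_subgroup[OF KU])
  have root: "elem_unitriangular n d t \<in> generate U K"
    if "c \<in> covers - J" "d \<in> avoiding (insert c J)" for c d t
    using that root_mem_stabilizer unfolding K_def by (blast intro: generate.incl)
  have m: "g * h \<in> generate U K" if "g \<in> generate U K" "h \<in> generate U K" for g h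
    using K.m_closed[OF that] by simp
  have "elem_unitriangular n d t \<in> generate U K" if d: "d \<in> avoiding J" for d t
  proof (cases "\<exists>c\<in>covers - J. d \<notin> through c")
    case True
    then show ?thesis using root[of _ d t] d by (auto simp: avoiding_def)
  next
    case False
    have "\<not> (\<forall>c\<in>covers - J. \<forall>c'\<in>covers - J. c = c')"
      unfolding card_le_Suc0_iff_eq[OF finite_Diff[OF finite_covers], symmetric] using card by simp
    then obtain c c' where cc: "c \<in> covers - J" "c' \<in> covers - J" "c \<noteq> c'" by blast
    obtain i j where ij: "d = (i, j)" by force
    obtain k where k: "(i, k) \<in> avoiding (insert c J) \<union> avoiding (insert c' J)"
      "(k, j) \<in> avoiding (insert c J) \<union> avoiding (insert c' J)"
      using avoiding_split[OF J cc] d False cc unfolding ij by blast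
    have r: "elem_unitriangular n (i, k) s \<in> generate U K" "elem_unitriangular n (k, j) s \<in> generate U K"
      for s using k root cc by blast+
    have D: "(i, k) \<in> Delta n" "(k, j) \<in> Delta n" using k in_Delta by (auto simp: avoiding_def)
    have "elem_unitriangular n (i, k) t * (elem_unitriangular n (k, j) 1 *
        (elem_unitriangular n (i, k) (- t) * elem_unitriangular n (k, j) (- 1))) \<in> generate U K"
      by (intro m r)
    then show ?thesis by (simp add: elem_unitriangular_commutator[OF D] ij)
  qed
  note root' = this
  have "carrier (pattern_group n (avoiding J)) \<subseteq> generate U K"
  proof
    fix g :: "'a mat" assume "g \<in> carrier (pattern_group n (avoiding J))"
    with closed_avoiding show "g \<in> generate U K"
    proof (induction rule: pattern_group_induct)
      case one then show ?case using K.one_closed by simp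
    next
      case (elem d t g) then show ?case using m root' by blast
    qed
  qed
  then show "stabilizer_of J \<subseteq> generate U (\<Union>c\<in>covers - J. stabilizer_of (insert c J))"
    unfolding K_def stabilizer_of_eq .
qed

section \<open>Residues of flags of corank one\<close>

text \<open>The residue of the flag of type \<open>covers - {c}\<close> at \<open>\<one>\<close>, with the type \<open>c\<close> dropped from its elements.\<close>

abbreviation panel_cosets :: "nat \<times> nat \<Rightarrow> 'a mat set set" where
  "panel_cosets c \<equiv> (\<lambda>u. u <#\<^bsub>U\<^esub> H c) ` stabilizer_of (covers - {c})"

abbreviation root_cosets :: "nat \<times> nat \<Rightarrow> 'a mat set set" where
  "root_cosets c \<equiv> range (\<lambda>t. elem_unitriangular n c t <#\<^bsub>U\<^esub> H c)"

lemma finite_panel_cosets: "finite (panel_cosets c)"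
proof (rule finite_imageI, rule finite_subset[OF _ finite_carrier_mat])
  show "stabilizer_of (covers - {c}) \<subseteq> carrier_mat n n" using U_D(1) by (auto simp: stabilizer_of_def)
qed

lemma card_root_cosets:
  assumes c: "c \<in> covers"
  shows "card (root_cosets c) = card (UNIV :: 'a set)"
proof (rule card_image, rule injI)
  fix s t :: 'a
  have cS: "c \<in> S" using c covers_subset by blast
  assume "elem_unitriangular n c s <#\<^bsub>U\<^esub> H c = elem_unitriangular n c t <#\<^bsub>U\<^esub> H c"
  then have "elem_unitriangular n c (t - s) \<in> H c"
    using coset_eq_iff[OF c root_mem_U[OF cS, of s] root_mem_U[OF cS, of t]]
    by (simp add: inv_root[OF cS] elem_unitriangular_add[OF in_Delta[OF cS]])
  then have "entry (elem_unitriangular n c (t - s)) (fst c) (snd c) = 0"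
    using through_self[OF c] unfolding H_iff by fastforce
  then show "s = t"
    using index_bounds[of "fst c" "snd c"] cS by (simp add: entry_elem_unitriangular)
qed

lemma root_cosets_subset:
  assumes c: "c \<in> covers"
  shows "root_cosets c \<subseteq> panel_cosets c"
proof -
  have "c \<in> avoiding (covers - {c})"
    using c covers_subset through_other[OF c] by (auto simp: avoiding_def)
  then show ?thesis using root_mem_stabilizer by blast
qed

text \<open>Dividing \<open>u\<close> by the root element at \<open>c\<close> with the same entry clears that entry. The result vanishes on
the rest of \<open>through c\<close> as well, where the elements of the stabilizer have no entries.\<close>

lemma panel_cosets_eq_root_cosets:
  assumes c: "c \<in> covers" and only: "through c \<inter> avoiding (covers - {c}) \<subseteq> {c}"
  shows "panel_cosets c = root_cosets c"
proof
  show "panel_cosets c \<subseteq> root_cosets c"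
  proof
    fix X assume "X \<in> panel_cosets c"
    then obtain u where u: "u \<in> stabilizer_of (covers - {c})" "X = u <#\<^bsub>U\<^esub> H c" by blast
    obtain a b where ab: "c = (a, b)" by force
    have cS: "c \<in> S" "a \<prec> b" using c covers_subset ab by auto
    note bd = index_bounds[OF cS(2)]
    have uU: "u \<in> carrier U" using u by (simp add: stabilizer_of_def)
    define t where "t = entry u a b"
    define w where "w = elem_unitriangular n c (- t) * u"
    have "elem_unitriangular n c (- t) \<in> stabilizer_of (covers - {c})"
      using cS(1) through_other[OF c] by (intro root_mem_stabilizer) (auto simp: avoiding_def)
    then have ws: "w \<in> stabilizer_of (covers - {c})"
      using u(1) pattern_group_mult_closed[OF closed_avoiding] unfolding w_def stabilizer_of_eq by blast
    have w: "w \<in> carrier (pattern_group n (avoiding (covers - {c})))" "w \<in> carrier U"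
      using ws stabilizer_of_eq stabilizer_of_def by blast+
    have "entry w i j = 0" if ij: "(i, j) \<in> through c" for i j
    proof (cases "(i, j) = c")
      case True
      then show ?thesis
        using bd in_Delta[OF cS(1)] U_D(1,2)[OF uU] by (simp add: w_def ab entry_elem_mult t_def)
    next
      case False
      then have "(i, j) \<notin> avoiding (covers - {c})" using only ij by blast
      moreover have "i \<prec> j" using ij by (simp add: through_def)
      ultimately show ?thesis using pattern_groupD(3)[OF w(1)] index_bounds by blast
    qed
    then have "w \<in> H c" using w(2) by (auto simp: H_iff)
    then have "inv\<^bsub>U\<^esub> (elem_unitriangular n c t) \<otimes>\<^bsub>U\<^esub> u \<in> H c"
      by (simp add: inv_root[OF cS(1)] w_def)
    then have "elem_unitriangular n c t <#\<^bsub>U\<^esub> H c = u <#\<^bsub>U\<^esub> H c"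
      using coset_eq_iff[OF c root_mem_U[OF cS(1)] uU] by blast
    then show "X \<in> root_cosets c" unfolding u(2) by blast
  qed
qed (rule root_cosets_subset[OF c])

lemma extra_coset:
  assumes c: "c \<in> covers" and d: "d \<in> through c" "d \<in> avoiding (covers - {c})" "d \<noteq> c"
  shows "elem_unitriangular n d 1 <#\<^bsub>U\<^esub> H c \<in> panel_cosets c - root_cosets c"
proof -
  obtain a b where ab: "c = (a, b)" by force
  obtain i j where ij: "d = (i, j)" by force
  have cS: "c \<in> S" "a \<prec> b" using c covers_subset ab by auto
  have dS: "d \<in> S" "i \<prec> j" using d ij by (auto simp: through_def)
  note bd = index_bounds[OF cS(2)] index_bounds[OF dS(2)]
  have "elem_unitriangular n d 1 <#\<^bsub>U\<^esub> H c \<noteq> elem_unitriangular n c t <#\<^bsub>U\<^esub> H c" for t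
  proof
    assume "elem_unitriangular n d 1 <#\<^bsub>U\<^esub> H c = elem_unitriangular n c t <#\<^bsub>U\<^esub> H c"
    then have "elem_unitriangular n c (- t) * elem_unitriangular n d 1 \<in> H c" (is "?x \<in> H c")
      using coset_eq_iff[OF c root_mem_U[OF cS(1), of t] root_mem_U[OF dS(1), of 1]]
      by (simp add: inv_root[OF cS(1)])
    then have "entry ?x a b = 0" "entry ?x i j = 0"
      using through_self[OF c] d(1) unfolding H_iff ab ij by blast+
    moreover have "entry ?x a b = - t"
      using bd in_Delta[OF cS(1)] d(3) by (auto simp: ab ij entry_elem_mult entry_elem_unitriangular)
    ultimately have "elem_unitriangular n c (- t) = 1\<^sub>m n" by simp
    then have "entry ?x i j = 1"
      using bd by (simp add: ij entry_elem_unitriangular left_mult_one_mat[OF elem_unitriangular_carrier])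
    then show False using \<open>entry ?x i j = 0\<close> by simp
  qed
  then show ?thesis using root_mem_stabilizer[OF d(2)] by blast
qed

lemma card_panel_cosets_ge:
  assumes c: "c \<in> covers"
  shows "card (UNIV :: 'a set) \<le> card (panel_cosets c)"
  using card_mono[OF finite_panel_cosets root_cosets_subset[OF c]] card_root_cosets[OF c] by simp

lemma card_panel_cosets_eq_iff:
  assumes c: "c \<in> covers"
  shows "card (panel_cosets c) = card (UNIV :: 'a set) \<longleftrightarrow> through c \<inter> avoiding (covers - {c}) \<subseteq> {c}"
proof
  assume card: "card (panel_cosets c) = card (UNIV :: 'a set)"
  then have "root_cosets c = panel_cosets c"
    using card_root_cosets[OF c] by (intro card_subset_eq finite_panel_cosets root_cosets_subset c) simp
  then have empty: "panel_cosets c - root_cosets c = {}" by simp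
  have "d = c" if "d \<in> through c" "d \<in> avoiding (covers - {c})" for d
    using extra_coset[OF c that] unfolding empty by (cases "d = c") simp_all
  then show "through c \<inter> avoiding (covers - {c}) \<subseteq> {c}" by blast
next
  assume "through c \<inter> avoiding (covers - {c}) \<subseteq> {c}"
  then show "card (panel_cosets c) = card (UNIV :: 'a set)"
    using panel_cosets_eq_root_cosets[OF c] card_root_cosets[OF c] by simp
qed

text \<open>If the pattern is not rigid, some root element of \<open>B\<close> has a commutator with the root element at a covering
relation \<open>c\<close> that is again a root element, but at a position in \<open>through c\<close>, and thus is not in \<open>B\<close>.\<close>

lemma normal_imp_rigid:
  assumes N: "stabilizer_of covers \<lhd> U"
  shows rigid
proof (rule ccontr)
  interpret B: subgroup "stabilizer_of covers" U by (rule normal_invE(1)[OF N])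
  have conj: "x * h * inv\<^bsub>U\<^esub> x \<in> stabilizer_of covers"
    if "x \<in> carrier U" "h \<in> stabilizer_of covers" for x h
    using normal_invE(2)[OF N that] by simp
  have no: "elem_unitriangular n d 1 \<notin> stabilizer_of covers" if "d \<in> through c" "c \<in> covers" for c d
  proof
    assume "elem_unitriangular n d 1 \<in> stabilizer_of covers"
    then have "elem_unitriangular n d 1 \<in> H c" using that by (simp add: stabilizer_of_def)
    then have "entry (elem_unitriangular n d (1 :: 'a)) (fst d) (snd d) = 0"
      using that(1) unfolding H_iff by fastforce
    moreover have "d \<in> S" using that by (simp add: through_def)
    ultimately show False
      using index_bounds[of "fst d" "snd d"] by (simp add: entry_elem_unitriangular)
  qed
  assume "\<not> rigid"
  then show False
  proof (cases rule: not_rigid_cases)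
    case (1 a b i)
    let ?r = "elem_unitriangular n (i, a) :: 'a \<Rightarrow> 'a mat" and ?c = "elem_unitriangular n (a, b) :: 'a \<Rightarrow> 'a mat"
    have S: "i \<prec> a" "a \<prec> b" using 1 covers_subset by (auto simp: avoiding_def)
    have "?r 1 * (?c 1 * ?r (- 1) * ?c (- 1)) \<in> stabilizer_of covers"
      using B.m_closed[OF root_mem_stabilizer[OF 1(2), of 1] conj[OF root_mem_U[OF S(2), of 1] root_mem_stabilizer[OF 1(2), of "- 1"]]]
      by (simp add: inv_root[OF S(2)])
    moreover have "?c 1 * ?r (- 1) * ?c (- 1) = ?c 1 * (?r (- 1) * ?c (- 1))"
      by (rule assoc_mult_mat[of _ n n _ n _ n]) auto
    ultimately have "elem_unitriangular n (i, b) 1 \<in> stabilizer_of covers"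
      using elem_unitriangular_commutator[OF in_Delta[OF S(1)] in_Delta[OF S(2)], of "1 :: 'a" 1] by simp
    then show False using no[OF 1(3,1)] by blast
  next
    case (2 a b k)
    let ?r = "elem_unitriangular n (b, k) :: 'a \<Rightarrow> 'a mat" and ?c = "elem_unitriangular n (a, b) :: 'a \<Rightarrow> 'a mat"
    have S: "b \<prec> k" "a \<prec> b" using 2 covers_subset by (auto simp: avoiding_def)
    have "?c 1 * ?r 1 * ?c (- 1) * ?r (- 1) \<in> stabilizer_of covers"
      using B.m_closed[OF conj[OF root_mem_U[OF S(2), of 1] root_mem_stabilizer[OF 2(2), of 1]] root_mem_stabilizer[OF 2(2), of "- 1"]]
      by (simp add: inv_root[OF S(2)])
    moreover have "?c 1 * ?r 1 * ?c (- 1) * ?r (- 1) = ?c 1 * ?r 1 * (?c (- 1) * ?r (- 1))"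
      by (rule assoc_mult_mat[of _ n n _ n _ n]) auto
    moreover have "\<dots> = ?c 1 * (?r 1 * (?c (- 1) * ?r (- 1)))"
      by (rule assoc_mult_mat[of _ n n _ n _ n]) auto
    ultimately have "elem_unitriangular n (a, k) 1 \<in> stabilizer_of covers"
      using elem_unitriangular_commutator[OF in_Delta[OF S(2)] in_Delta[OF S(1)], of "1 :: 'a" 1] by simp
    then show False using no[OF 2(3,1)] by blast
  qed
qed

text \<open>Put \<open>w = x h x\<inverse>\<close>. As \<open>avoiding covers\<close> is an ideal, in the remaining positions \<open>w x = x h\<close> has the same
entries as \<open>x\<close>. Comparing with the expansion of \<open>w x\<close> shows, by induction on the column, that \<open>w\<close>
vanishes there.\<close>

lemma rigid_imp_normal:
  assumes rigid
  shows "stabilizer_of covers \<lhd> U"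
proof (rule normal_invI)
  have "stabilizer_of covers = carrier (pattern_group n (avoiding covers))" by (rule stabilizer_of_eq)
  then show "subgroup (stabilizer_of covers) U"
    unfolding U_eq by (simp add: subgroup_pattern_group closed closed_avoiding avoiding_subset)
  fix x h assume x: "x \<in> carrier U" and h: "h \<in> stabilizer_of covers"
  have hU: "h \<in> carrier U" using h by (simp add: stabilizer_of_def)
  have hz: "entry h k j = 0" if "k \<in> {1..n}" "j \<in> {1..n}" "k \<noteq> j" "(k, j) \<notin> avoiding covers" for k j
    using h that pattern_groupD(3) unfolding stabilizer_of_eq by blast
  define w where "w = x \<otimes>\<^bsub>U\<^esub> h \<otimes>\<^bsub>U\<^esub> inv\<^bsub>U\<^esub> x"
  have w: "w \<in> carrier U" unfolding w_def using x hU by (intro m_closed inv_closed)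
  have "w \<otimes>\<^bsub>U\<^esub> x = x \<otimes>\<^bsub>U\<^esub> h" unfolding w_def using x hU by (simp only: m_assoc m_closed inv_closed l_inv r_one)
  then have wx: "w * x = x * h" by simp
  have "entry w i j = 0" if "i \<prec> j" "(i, j) \<notin> avoiding covers" for i j
    using that
  proof (induction j rule: less_induct)
    case (less j)
    have b: "i \<in> {1..n}" "j \<in> {1..n}" "i \<noteq> j" using index_bounds less.prems by blast+
    have "entry (x * h) i j = (\<Sum>k\<in>{1..n}. entry x i k * entry h k j)"
      by (rule entry_mult[OF U_D(1)[OF x] U_D(1)[OF hU] b(1,2)])
    also have "\<dots> = (\<Sum>k\<in>{j}. entry x i k * entry h k j)"
    proof (rule sum.mono_neutral_right)
      show "\<forall>k\<in>{1..n} - {j}. entry x i k * entry h k j = 0"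
      proof
        fix k assume k: "k \<in> {1..n} - {j}"
        consider "k = i" | "k \<noteq> i" "\<not> i \<prec> k" | "i \<prec> k" by blast
        then show "entry x i k * entry h k j = 0"
        proof cases
          case 1 then show ?thesis using hz b less.prems by simp
        next
          case 2 then show ?thesis using U_D(3)[OF x b(1), of k] k by simp
        next
          case 3
          then have "(k, j) \<notin> avoiding covers" using less.prems(2) rigid_imp_ideal_left[OF assms] by blast
          then show ?thesis using hz b k by simp
        qed
      qed
    qed (use b in auto)
    also have "\<dots> = entry x i j" using U_D(2)[OF hU b(2)] by simp
    finally have xh: "entry (x * h) i j = entry x i j" .
    have "entry (w * x) i j = (\<Sum>k\<in>{1..n}. entry w i k * entry x k j)"
      by (rule entry_mult[OF U_D(1)[OF w] U_D(1)[OF x] b(1,2)])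
    also have "\<dots> = (\<Sum>k\<in>{i, j}. entry w i k * entry x k j)"
    proof (rule sum.mono_neutral_right)
      show "\<forall>k\<in>{1..n} - {i, j}. entry w i k * entry x k j = 0"
      proof
        fix k assume k: "k \<in> {1..n} - {i, j}"
        consider "\<not> i \<prec> k" | "\<not> k \<prec> j" | "i \<prec> k" "k \<prec> j" by blast
        then show "entry w i k * entry x k j = 0"
        proof cases
          case 1 then show ?thesis using U_D(3)[OF w b(1), of k] k by simp
        next
          case 2 then show ?thesis using U_D(3)[OF x _ b(2), of k] k by simp
        next
          case 3
          then have "(i, k) \<notin> avoiding covers" using less.prems(2) rigid_imp_ideal_right[OF assms] by blast
          then show ?thesis using less.IH[of k] 3 less_imp[OF 3(2)] by simp
        qed
      qed
    qed (use b in auto)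
    also have "\<dots> = entry x i j + entry w i j" using b U_D(2)[OF w b(1)] U_D(2)[OF x b(2)] by simp
    finally show ?case using xh wx by simp
  qed
  then have "\<forall>(i, j)\<in>(S - avoiding covers) \<inter> Delta n. entry w i j = 0" by auto
  then have "w \<in> carrier (pattern_group n (avoiding covers))"
    using w pattern_group_subpattern_iff[OF avoiding_subset] unfolding U_eq by blast
  then show "x \<otimes>\<^bsub>U\<^esub> h \<otimes>\<^bsub>U\<^esub> inv\<^bsub>U\<^esub> x \<in> stabilizer_of covers"
    by (simp only: stabilizer_of_eq w_def)
qed

lemma normal_iff_rigid: "stabilizer_of covers \<lhd> U \<longleftrightarrow> rigid"
  using normal_imp_rigid rigid_imp_normal by blast

lemma two_le_card: "card (UNIV :: 'a set) \<ge> 2"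
proof -
  have "card {0, 1 :: 'a} \<le> card (UNIV :: 'a set)" by (rule card_mono) auto
  then show ?thesis by simp
qed

lemma finite_residue: "finite (elements (residue cosets F))"
proof (rule finite_subset)
  show "elements (residue cosets F) \<subseteq> (\<lambda>(c, g). (c, g <#\<^bsub>U\<^esub> H c)) ` (covers \<times> carrier U)"
    by (auto simp: residue_def)
  have "finite (carrier U)" by (rule finite_subset[OF _ finite_carrier_mat]) (use U_D(1) in blast)
  then show "finite ((\<lambda>(c, g). (c, g <#\<^bsub>U\<^esub> H c)) ` (covers \<times> carrier U))"
    using finite_covers by blast
qed

lemma firm_cosets: "firm cosets"
  using corank_one_residues[of "\<lambda>k. 2 \<le> k"] card_panel_cosets_ge two_le_card
  unfolding firm_def by (meson le_trans)

lemma thin_cosets_iff: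
  assumes "S \<noteq> {}"
  shows "thin cosets \<longleftrightarrow> card (UNIV :: 'a set) = 2 \<and> stabilizer_of covers \<lhd> U"
proof -
  have "thin cosets \<longleftrightarrow> (\<forall>c\<in>covers. card (panel_cosets c) = 2)"
    unfolding thin_def by (rule corank_one_residues)
  also have "\<dots> \<longleftrightarrow> (\<forall>c\<in>covers. card (UNIV :: 'a set) = 2 \<and> card (panel_cosets c) = card (UNIV :: 'a set))"
    using card_panel_cosets_ge two_le_card by (metis le_antisym)
  also have "\<dots> \<longleftrightarrow> card (UNIV :: 'a set) = 2 \<and> rigid"
    using covers_nonempty[OF assms] unfolding rigid_def by (auto simp: card_panel_cosets_eq_iff)
  finally show ?thesis by (simp add: normal_iff_rigid)
qed

lemma thick_cosets_iff: "thick cosets \<longleftrightarrow> (\<forall>c\<in>covers. card (panel_cosets c) > 2)"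
  using corank_one_residues[of "\<lambda>k. k > 2"] finite_residue unfolding thick_def by simp

lemma thick_cosets:
  assumes "card (UNIV :: 'a set) \<noteq> 2"
  shows "thick cosets"
  unfolding thick_cosets_iff
proof
  fix c assume "c \<in> covers"
  then show "2 < card (panel_cosets c)"
    using card_panel_cosets_ge[of c] two_le_card assms by linarith
qed

lemma not_thick_cosets:
  assumes "S \<noteq> {}" and "stabilizer_of covers \<lhd> U" and "thick cosets"
  shows "card (UNIV :: 'a set) \<noteq> 2"
proof
  assume two: "card (UNIV :: 'a set) = 2"
  obtain c where c: "c \<in> covers" using covers_nonempty[OF assms(1)] by blast
  have "card (panel_cosets c) = 2"
    using card_panel_cosets_eq_iff[OF c] assms(2) c two by (simp add: normal_iff_rigid rigid_def)
  then show False using assms(3) c unfolding thick_cosets_iff by fastforce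
qed

end

section \<open>The theorem\<close>

theorem theorem3p9:
  fixes n p m q :: nat
    and T :: "'a::{field,finite} set"
    and Ihat I :: "(nat \<times> nat) set"
    and U :: "'a mat monoid"
    and H :: "nat \<times> nat \<Rightarrow> 'a mat set"
    and \<Gamma> :: "((nat \<times> nat) \<times> 'a mat set, nat \<times> nat) incidence_structure"
    and B :: "'a mat set"
  assumes "n \<ge> 2"
    and "prime p" and "m \<ge> 1" and "q = p ^ m"
    and "card (UNIV :: 'a set) = q"
    and "prime_field_basis T"
    and "closed_pattern n Ihat"
    and "I = covering_relations Ihat"
    and "U = pattern_group n Ihat"
    and "\<And>c. H c = generate U {elem_unitriangular n d t | t d. t \<in> T \<and> d \<in> I - {c}}"
    and "\<Gamma> = coset_incidence_system U I H"
    and "B = carrier U \<inter> (\<Inter>c\<in>I. H c)"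
  shows "acts_flag_transitively U I H \<and>
    (coset_geometry U I H \<and> residually_connected \<Gamma>) \<and>
    firm \<Gamma> \<and>
    (Ihat \<noteq> {} \<longrightarrow> (thin \<Gamma> \<longleftrightarrow> q = 2 \<and> B \<lhd> U)) \<and>
    ((q \<noteq> 2 \<longrightarrow> thick \<Gamma>) \<and>
     (Ihat \<noteq> {} \<longrightarrow> (B \<lhd> U \<and> thick \<Gamma> \<longrightarrow> q \<noteq> 2)))"
proof -
  interpret P: pattern_geometry n Ihat U
    using assms(7,9) by unfold_locales
  have I: "I = P.covers" by (simp add: P.covers_def assms(8))
  have H: "H = P.H"
  proof
    fix c
    have "P.covers - {c} \<subseteq> Ihat" using P.covers_subset by blast
    then show "H c = P.H c"
      unfolding assms(10) I P.H_def unfolding assms(9)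
      by (rule generate_pattern_group[OF assms(7) _ assms(6)])
  qed
  have \<Gamma>: "\<Gamma> = P.cosets" by (simp add: assms(11) I H)
  have B: "B = P.stabilizer_of P.covers" by (simp add: assms(12) I H P.stabilizer_of_def)
  have "coset_geometry U I H"
    unfolding coset_geometry_def I H
    using P.is_group P.subgroups P.incidence_geometry_cosets by blast
  then show ?thesis
    using P.acts_flag_transitively P.residually_connected_cosets P.firm_cosets P.thin_cosets_iff
      P.thick_cosets P.not_thick_cosets assms(5)
    unfolding \<Gamma> B unfolding I H by blast
qed

end
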